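(* Let $(X,\mathcal A,\mu,T)$ be an ergodic invertible dynamical system and let $\mathcal F$ be a sub-$\sigma$-algebra of $\mathcal A$ such that $\mathcal F\subset T^{-1}\mathcal F$. Let $\Phi:X\to\mathbb R^d$ be square integrable, $\mathcal F$-measurable and such that $(\Phi\circ T^n)_{n\in\mathbb Z}$ is a sequence of martingale increments with respect to $(T^{-n}\mathcal F)_{n\in\mathbb Z}$ (equivalently, $\mathbb E(\Phi\mid T\mathcal F)=0$). Assume that $\Phi$ is not contained a.s. in a fixed hyperplane of $\mathbb R^d$. Then $\mathcal{ED}(\Phi)=\mathbb S^{d-1}$.
   Context: $(X,\mathcal A)$ is a standard Borel space, $\mu$ a $T$-invariant probability measure. Fix a norm on $\mathbb R^d$, with unit sphere $\mathbb S^{d-1}$. For $\Phi$ measurable, $\Phi_n(x)=\sum_{k=0}^{n-1}\Phi(T^kx)$, $n\ge1$. A vector $u\in\mathbb S^{d-1}$ is a limit direction of $(\Phi_n(x))$ at $x$ if there is a subsequence $(n_k(x))$ with $\|\Phi_{n_k}(x)\|\to\infty$ and $\Phi_{n_k}(x)/\|\Phi_{n_k}(x)\|\to u$; $u$ is a limit direction of the cocycle if this holds for a.e. $x$ (by ergodicity it holds for a.e. $x$ or for a.e. no $x$). For measurable $B$ with $\mu(B)>0$: $R_B(x)=\inf\{j\ge1:T^jx\in B\}$, the induced map is $T_B(x)=T^{R_B(x)}x$ on $B$ (with normalized measure $\mu_B=\mu(B)^{-1}\mu_{|B}$), and the induced cocycle is generated over $T_B$ by $\Phi^B(x)=\sum_{j=0}^{R_B(x)-1}\Phi(T^jx)$,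 i.e. $\Phi^B_n(x)=\sum_{k=0}^{n-1}\Phi^B(T_B^kx)$. A direction $u\in\mathbb S^{d-1}$ is an essential limit direction of $\Phi$ if for every measurable $B$ with $\mu(B)>0$, $u$ is a limit direction of the induced cocycle $(\Phi^B_n)$ over $(B,\mu_B,T_B)$. $\mathcal{ED}(\Phi)$ is the set of essential limit directions. *)

theory Defs
  imports "HOL-Probability.Probability"
begin

section \<open>Norms on \<open>\<real>\<^sup>d\<close>\<close>

definition is_norm :: "('v::real_vector \<Rightarrow> real) \<Rightarrow> bool" where
  "is_norm N \<longleftrightarrow>
     (\<forall>x. 0 \<le> N x) \<and> (\<forall>x. N x = 0 \<longleftrightarrow> x = 0) \<and>
     (\<forall>c x. N (c *\<^sub>R x) = \<bar>c\<bar> * N x) \<and> (\<forall>x y. N (x + y) \<le> N x + N y)"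

definition unit_sphere :: "('v \<Rightarrow> real) \<Rightarrow> 'v set" where
  "unit_sphere N = {u. N u = 1}"

section \<open>Ergodic invertible dynamical systems\<close>

definition standard_borel :: "'a measure \<Rightarrow> bool" where
  "standard_borel M \<longleftrightarrow>
     (\<exists>X. completely_metrizable_space X \<and> second_countable X \<and> topspace X = space M \<and>
          sets M = sigma_sets (space M) {U. openin X U})"

definition invertible_mps :: "'a measure \<Rightarrow> ('a \<Rightarrow> 'a) \<Rightarrow> bool" where
  "invertible_mps M T \<longleftrightarrow>
     standard_borel M \<and> prob_space M \<and> bij_betw T (space M) (space M) \<and>
     T \<in> measurable M M \<and> the_inv_into (space M) T \<in> measurable M M \<and>
     distr M M T = M"

definition ergodic :: "'a measure \<Rightarrow> ('a \<Rightarrow> 'a) \<Rightarrow> bool" where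
  "ergodic M T \<longleftrightarrow>
     (\<forall>A\<in>sets M. T -` A \<inter> space M = A \<longrightarrow> emeasure M A = 0 \<or> emeasure M A = 1)"

definition int_iterate :: "'a measure \<Rightarrow> ('a \<Rightarrow> 'a) \<Rightarrow> int \<Rightarrow> 'a \<Rightarrow> 'a" where
  "int_iterate M T n =
     (if 0 \<le> n then T ^^ nat n else (the_inv_into (space M) T) ^^ nat (- n))"

text \<open>
  A sub-\<open>\<sigma>\<close>-algebra is represented, as in \<^const>\<open>subalgebra\<close>, by a measure of which only the
  underlying measurable space matters. The following is \<open>T\<^sup>-\<^sup>n \<F>\<close>.
\<close>

definition pullback_algebra :: "'a measure \<Rightarrow> ('a \<Rightarrow> 'a) \<Rightarrow> 'a measure \<Rightarrow> int \<Rightarrow> 'a measure" where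
  "pullback_algebra M T F n = vimage_algebra (space M) (int_iterate M T n) F"

section \<open>Martingale increments indexed by the integers\<close>

text \<open>The conditional expectation of a vector-valued function is taken coordinatewise.\<close>

definition martingale_increments ::
    "'a measure \<Rightarrow> (int \<Rightarrow> 'a measure) \<Rightarrow> (int \<Rightarrow> 'a \<Rightarrow> real ^ 'n) \<Rightarrow> bool" where
  "martingale_increments M G Y \<longleftrightarrow>
     (\<forall>n. subalgebra M (G n)) \<and> (\<forall>n. sets (G n) \<subseteq> sets (G (n + 1))) \<and>
     (\<forall>n. Y n \<in> borel_measurable (G n)) \<and> (\<forall>n. integrable M (Y n)) \<and>
     (\<forall>n i. AE x in M. real_cond_exp M (G (n - 1)) (\<lambda>x. Y n x $ i) x = 0)"

section \<open>Limit directions of cocycles\<close>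

definition birkhoff_sum :: "('a \<Rightarrow> 'a) \<Rightarrow> ('a \<Rightarrow> 'v::comm_monoid_add) \<Rightarrow> nat \<Rightarrow> 'a \<Rightarrow> 'v" where
  "birkhoff_sum T f n x = (\<Sum>k<n. f ((T ^^ k) x))"

definition limit_direction_of_seq :: 
    "('v::real_normed_vector \<Rightarrow> real) \<Rightarrow> (nat \<Rightarrow> 'v) \<Rightarrow> 'v \<Rightarrow> bool" where
  "limit_direction_of_seq N s u \<longleftrightarrow>
     (\<exists>r. strict_mono r \<and>
          filterlim (\<lambda>k. N (s (r k))) at_top sequentially \<and>
          (\<lambda>k. s (r k) /\<^sub>R N (s (r k))) \<longlonglongrightarrow> u)"

definition limit_direction ::
    "('v::real_normed_vector \<Rightarrow> real) \<Rightarrow> 'a measure \<Rightarrow> ('a \<Rightarrow> 'a) \<Rightarrow> ('a \<Rightarrow> 'v) \<Rightarrow> 'v \<Rightarrow> bool" where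
  "limit_direction N M T f u \<longleftrightarrow>
     (AE x in M. limit_direction_of_seq N (\<lambda>n. birkhoff_sum T f n x) u)"

section \<open>Induced cocycles and essential limit directions\<close>

text \<open>
  Points that never return to \<open>B\<close> get return time \<open>0\<close> instead of infinity; if \<open>T\<close> preserves a
  finite measure, they form a null subset of \<open>B\<close> by Poincare recurrence.
\<close>

definition return_time :: "('a \<Rightarrow> 'a) \<Rightarrow> 'a set \<Rightarrow> 'a \<Rightarrow> nat" where
  "return_time T B x = Inf {j. 1 \<le> j \<and> (T ^^ j) x \<in> B}"

definition induced_map :: "('a \<Rightarrow> 'a) \<Rightarrow> 'a set \<Rightarrow> 'a \<Rightarrow> 'a" where
  "induced_map T B x = (T ^^ return_time T B x) x"

definition induced_measure :: "'a measure \<Rightarrow> 'a set \<Rightarrow> 'a measure" where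
  "induced_measure M B = scale_measure (inverse (emeasure M B)) (restrict_space M B)"

definition induced_function ::
    "('a \<Rightarrow> 'a) \<Rightarrow> 'a set \<Rightarrow> ('a \<Rightarrow> 'v::comm_monoid_add) \<Rightarrow> 'a \<Rightarrow> 'v" where
  "induced_function T B f x = birkhoff_sum T f (return_time T B x) x"

definition essential_limit_directions ::
    "('v::real_normed_vector \<Rightarrow> real) \<Rightarrow> 'a measure \<Rightarrow> ('a \<Rightarrow> 'a) \<Rightarrow> ('a \<Rightarrow> 'v) \<Rightarrow> 'v set" where
  "essential_limit_directions N M T f =
     {u \<in> unit_sphere N. \<forall>B\<in>sets M. emeasure M B > 0 \<longrightarrow>
        limit_direction N (induced_measure M B) (induced_map T B) (induced_function T B f) u}"

end

theory Submission
  imports Defs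
begin

text \<open>
  If \<open>u\<close> were not an essential limit direction, there would be a set \<open>E\<close> of positive measure such
  that \<open>\<Phi>\<^sub>n(x)\<close> avoids the far part of a cone around \<open>u\<close> whenever \<open>x\<close> and \<open>T\<^sup>n x\<close> are in \<open>E\<close>.
  By ergodicity most orbits visit \<open>E\<close> within a fixed time, so it is enough that
  \<open>\<Phi>\<^sub>n / \<surd>n\<close> lies in a given ball around \<open>u\<close> with probability at least some \<open>c > 0\<close>, for
  arbitrarily large \<open>n\<close>.

  This consequence of the central limit theorem has a direct proof. Let a ball of radius \<open>r\<close> move
  with constant speed from \<open>0\<close> at time \<open>0\<close> to \<open>u\<close> at time \<open>n\<close>, on the scale \<open>\<surd>n\<close>, and let \<open>W\<close> be the
  positive part of \<open>r\<^sup>2 - |y|\<^sup>2\<close>, where \<open>y\<close> is the position relative to the centre. Since the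
  covariance is positive definite, \<open>exp (\<lambda> t) W\<^sup>3\<close> is a subsolution of the backward heat equation for
  large \<open>\<lambda>\<close>. Hence the expectation of \<open>W\<^sup>3\<close> loses at most a constant factor up to time \<open>n\<close>.
  The second-order term is compared with the covariance over blocks of fixed length, in which the
  mixed terms vanish by the martingale property and the squares average out by the ergodic theorem
  in \<open>L\<^sup>1\<close>.
\<close>

section \<open>The ergodic theorem\<close>

lemma birkhoff_sum_0 [simp]: "birkhoff_sum T f 0 x = 0"
  by (simp add: birkhoff_sum_def)

lemma birkhoff_sum_Suc: "birkhoff_sum T f (Suc n) x = f x + birkhoff_sum T f n (T x)"
  unfolding birkhoff_sum_def
  by (subst sum.lessThan_Suc_shift) (simp add: funpow_swap1)

lemma birkhoff_sum_add:
  "birkhoff_sum T f (m + n) x = birkhoff_sum T f m x + birkhoff_sum T f n ((T ^^ m) x)"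
proof (induction m arbitrary: x)
  case (Suc m)
  then show ?case by (simp add: birkhoff_sum_Suc add.assoc funpow_swap1)
qed simp

section \<open>Forward iterates of a measure-preserving map and maximal sums\<close>

locale ergodic_mps = prob_space M for M :: "'a measure" +
  fixes T :: "'a \<Rightarrow> 'a"
  assumes T_measurable [measurable]: "T \<in> measurable M M"
    and distr_T: "distr M M T = M"
    and ergodic_T: "ergodic M T"
begin

lemma iter_measurable [measurable]: "T ^^ k \<in> measurable M M"
  by (rule measurable_compose_n) simp

lemma distr_iter: "distr M M (T ^^ k) = M"
proof (induction k)
  case 0
  then show ?case by (simp add: distr_id2 id_def)
next
  case (Suc k)
  then show ?case
    using distr_distr[of T M M "T ^^ k" M] distr_T by (simp add: o_def)
qed

lemma integral_iter:
  fixes f :: "'a \<Rightarrow> 'b::{banach, second_countable_topology}"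
  assumes "f \<in> borel_measurable M"
  shows "(\<integral>x. f ((T ^^ k) x) \<partial>M) = (\<integral>x. f x \<partial>M)"
  using integral_distr[of "T ^^ k" M M f] assms by (simp add: distr_iter)

lemma integrable_iter:
  fixes f :: "'a \<Rightarrow> 'b::{banach, second_countable_topology}"
  assumes "integrable M f"
  shows "integrable M (\<lambda>x. f ((T ^^ k) x))"
  using integrable_distr[of "T ^^ k" M M f] assms by (simp add: distr_iter)

lemma prob_iter:
  assumes "A \<in> sets M"
  shows "prob {x \<in> space M. (T ^^ k) x \<in> A} = prob A"
proof -
  have "{x \<in> space M. (T ^^ k) x \<in> A} = (T ^^ k) -` A \<inter> space M" by auto
  then show ?thesis
    using measure_distr[of "T ^^ k" M M A] assms by (simp add: distr_iter)
qed

lemma T_space: "x \<in> space M \<Longrightarrow> T x \<in> space M"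
  by (rule measurable_space[OF T_measurable])

lemma iter_space: "x \<in> space M \<Longrightarrow> (T ^^ k) x \<in> space M"
  by (rule measurable_space[OF iter_measurable])

lemma birkhoff_sum_measurable [measurable]:
  fixes f :: "'a \<Rightarrow> 'b::{real_normed_vector, second_countable_topology}"
  assumes [measurable]: "f \<in> borel_measurable M"
  shows "birkhoff_sum T f n \<in> borel_measurable M"
  unfolding birkhoff_sum_def by measurable

lemma integrable_birkhoff_sum:
  fixes f :: "'a \<Rightarrow> 'b::{banach, second_countable_topology}"
  assumes "integrable M f"
  shows "integrable M (birkhoff_sum T f n)"
  unfolding birkhoff_sum_def using assms by (intro Bochner_Integration.integrable_sum integrable_iter)

lemma invariant_set_01:
  assumes [measurable]: "Measurable.pred M P" and "\<And>x. x \<in> space M \<Longrightarrow> P (T x) \<longleftrightarrow> P x"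
  shows "(AE x in M. P x) \<or> (AE x in M. \<not> P x)"
proof -
  let ?A = "{x \<in> space M. P x}"
  have "T -` ?A \<inter> space M = ?A" using assms(2) T_space by auto
  moreover have "?A \<in> sets M" by measurable
  ultimately have "emeasure M ?A = 0 \<or> emeasure M ?A = 1"
    using ergodic_T unfolding ergodic_def by blast
  then show ?thesis
  proof
    assume "emeasure M ?A = 0"
    then have "AE x in M. \<not> P x" by (subst AE_iff_measurable[OF _ refl]) auto
    then show ?thesis by simp
  next
    assume "emeasure M ?A = 1"
    then have "prob ?A = 1" by (simp add: emeasure_eq_measure)
    then have "AE x in M. P x" by (subst (asm) prob_Collect_eq_1) auto
    then show ?thesis by simp
  qed
qed

text \<open>Since \<open>M\<^sub>n\<^sub>+\<^sub>1 - M\<^sub>n \<circ> T = max (- M\<^sub>n \<circ> T) f\<close> has nonnegative integral and tends to \<open>f\<close> where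
  \<open>M\<^sub>n\<close> is unbounded, unboundedness almost everywhere would force \<open>\<integral>f \<ge> 0\<close>.\<close>

lemma birkhoff_sum_bounded_above:
  fixes f :: "'a \<Rightarrow> real"
  assumes f [measurable]: "integrable M f" and neg: "(\<integral>x. f x \<partial>M) < 0"
  shows "AE x in M. \<exists>C. \<forall>n. birkhoff_sum T f n x \<le> C"
proof -
  \<comment> \<open>\<open>mx n x\<close> is the maximum of \<open>birkhoff_sum T f k x\<close> over
    k \<le> n, with the empty sum included. The recursive form makes the relation between x and T x
    immediate.\<close>
  define mx where "mx = rec_nat (\<lambda>x. 0::real) (\<lambda>_ g x. max 0 (f x + g (T x)))"
  have mx0: "mx 0 x = 0" for x by (simp add: mx_def)
  have mxS: "mx (Suc n) x = max 0 (f x + mx n (T x))" for n x by (simp add: mx_def)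
  have nonneg: "0 \<le> mx n x" for n x by (cases n) (auto simp: mx0 mxS)
  have step: "mx n x \<le> mx (Suc n) x" for n x
  proof (induction n arbitrary: x)
    case 0
    then show ?case by (simp add: mx0 nonneg)
  next
    case (Suc n)
    show ?case using Suc[of "T x"] unfolding mxS[of "Suc n" x] mxS[of n x] by simp
  qed
  have mono: "m \<le> n \<Longrightarrow> mx m x \<le> mx n x" for m n x
    by (rule lift_Suc_mono_le[of "\<lambda>n. mx n x"]) (auto intro: step)
  have sum_le: "birkhoff_sum T f n x \<le> mx n x" for n x
  proof (induction n arbitrary: x)
    case (Suc n)
    show ?case unfolding mxS birkhoff_sum_Suc using Suc[of "T x"] by simp
  qed (simp add: mx0)
  have mx_int: "integrable M (mx n)" for n
  proof (induction n)
    case 0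
    then show ?case by (simp add: mx_def)
  next
    case (Suc n)
    have "integrable M (\<lambda>x. f x + mx n (T x))"
      using integrable_iter[OF Suc, of 1] f by simp
    then show ?case unfolding mxS[abs_def] by simp
  qed
  note [measurable] = borel_measurable_integrable[OF mx_int]
  define P where "P x \<longleftrightarrow> (\<forall>C::nat. \<exists>n. mx n x > real C)" for x
  have P_alt: "P x \<longleftrightarrow> (\<forall>C. \<exists>n. mx n x > C)" for x
    unfolding P_def by (metis less_trans reals_Archimedean2)
  have [measurable]: "Measurable.pred M P"
    unfolding P_def by measurable
  have inv: "P (T x) \<longleftrightarrow> P x" for x
  proof
    assume P: "P (T x)"
    show "P x" unfolding P_alt
    proof
      fix C
      obtain n where "mx n (T x) > C - f x" using P unfolding P_alt by blast
      then have "mx (Suc n) x > C" by (simp add: mxS)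
      then show "\<exists>n. mx n x > C" ..
    qed
  next
    assume P: "P x"
    show "P (T x)" unfolding P_alt
    proof
      fix C
      \<comment> \<open>The threshold is kept nonnegative so that n cannot be 0 and the outer
        maximum with 0 in \<open>mxS\<close> is not attained at 0.\<close>
      obtain n where n: "mx n x > max 0 (C + f x)" using P unfolding P_alt by blast
      then obtain m where "n = Suc m" using mx0 by (cases n) auto
      with n have "mx m (T x) > C" by (auto simp: mxS)
      then show "\<exists>n. mx n (T x) > C" ..
    qed
  qed
  have "\<not> (AE x in M. P x)"
  proof
    assume AE: "AE x in M. P x"
    define g where "g n x = max (- mx n (T x)) (f x)" for n x
    have g: "g n x = mx (Suc n) x - mx n (T x)" for n x by (simp add: g_def mxS max_def)
    have mxT: "integrable M (\<lambda>x. mx n (T x))" for n using integrable_iter[OF mx_int[of n], of 1] by simp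
    have g_meas [measurable]: "g n \<in> borel_measurable M" for n
      unfolding g_def by measurable
    have "(\<integral>x. g n x \<partial>M) \<ge> 0" for n
    proof -
      have "(\<integral>x. g n x \<partial>M) = (\<integral>x. mx (Suc n) x \<partial>M) - (\<integral>x. mx n (T x) \<partial>M)"
        unfolding g using mx_int mxT by (rule Bochner_Integration.integral_diff)
      moreover have "(\<integral>x. mx n (T x) \<partial>M) = (\<integral>x. mx n x \<partial>M)"
        using integral_iter[of "mx n" 1] by simp
      moreover have "(\<integral>x. mx n x \<partial>M) \<le> (\<integral>x. mx (Suc n) x \<partial>M)"
        by (intro integral_mono mx_int step)
      ultimately show ?thesis by simp
    qed
    moreover have "(\<lambda>n. \<integral>x. g n x \<partial>M) \<longlonglongrightarrow> (\<integral>x. f x \<partial>M)"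
    proof (rule integral_dominated_convergence[where w="\<lambda>x. \<bar>f x\<bar>"])
      show "AE x in M. (\<lambda>n. g n x) \<longlonglongrightarrow> f x"
        using AE
      proof eventually_elim
        case (elim x)
        then have "P (T x)" by (simp add: inv)
        then obtain n0 where n0: "mx n0 (T x) > - f x" unfolding P_alt by blast
        have "g n x = f x" if "n \<ge> n0" for n
          using mono[OF that, of "T x"] n0 by (simp add: g_def)
        then show ?case
          by (intro tendsto_eventually) (auto simp: eventually_sequentially)
      qed
      \<comment> \<open>Since \<open>mx\<close> is nonnegative, \<open>g n x\<close> lies between f
        x and max 0 (f x).\<close>
      show "AE x in M. norm (g n x) \<le> \<bar>f x\<bar>" for n
      proof (rule AE_I2)
        fix x
        show "norm (g n x) \<le> \<bar>f x\<bar>"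
          using nonneg[of n "T x"] unfolding g_def real_norm_def by linarith
      qed
    qed (use f in auto)
    ultimately have "(\<integral>x. f x \<partial>M) \<ge> 0"
      by (meson LIMSEQ_le_const)
    with neg show False by simp
  qed
  then have "AE x in M. \<not> P x" using invariant_set_01[of P] inv by auto
  then show ?thesis
  proof eventually_elim
    case (elim x)
    then obtain C where "\<And>n. mx n x \<le> C" unfolding P_alt by (auto simp: not_less)
    then show ?case using sum_le by (intro exI[of _ C]) (meson order_trans)
  qed
qed

text \<open>After subtracting the mean plus e/2, the function has integral -e/2, so its sums are
  bounded above almost everywhere. Dividing by n makes the bound smaller than the remaining
  e/2.\<close>

lemma birkhoff_average_less:
  fixes f :: "'a \<Rightarrow> real"
  assumes f: "integrable M f" and e: "e > 0"
  shows "AE x in M. \<forall>\<^sub>F n in sequentially. birkhoff_sum T f n x / n < (\<integral>x. f x \<partial>M) + e"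
proof -
  let ?c = "(\<integral>x. f x \<partial>M)"
  have "AE x in M. \<exists>C. \<forall>n. birkhoff_sum T (\<lambda>x. f x - (?c + e/2)) n x \<le> C"
    by (rule birkhoff_sum_bounded_above) (use f e in \<open>auto simp: prob_space\<close>)
  then show ?thesis
  proof eventually_elim
    case (elim x)
    then obtain C where C: "\<And>n. birkhoff_sum T f n x - n * (?c + e/2) \<le> C"
      by (auto simp: birkhoff_sum_def sum_subtractf)
    obtain n0 :: nat where n0: "n0 > 2 * \<bar>C\<bar> / e" using reals_Archimedean2 by blast
    have "birkhoff_sum T f n x / n < ?c + e" if n: "n \<ge> Suc n0" for n
    proof -
      have "2 * \<bar>C\<bar> < n * e"
      proof -
        have "2 * \<bar>C\<bar> < n0 * e" using n0 e by (simp add: field_simps)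
        also have "\<dots> \<le> n * e" using n e by simp
        finally show ?thesis .
      qed
      then have "birkhoff_sum T f n x < n * (?c + e)"
        using C[of n] by (simp add: algebra_simps abs_real_def split: if_splits)
      then show ?thesis using n by (simp add: field_simps)
    qed
    then show ?case by (auto simp: eventually_sequentially)
  qed
qed

section \<open>Convergence of averages almost everywhere and in mean\<close>

theorem birkhoff_AE:
  fixes f :: "'a \<Rightarrow> real"
  assumes f: "integrable M f"
  shows "AE x in M. (\<lambda>n. birkhoff_sum T f n x / n) \<longlonglongrightarrow> (\<integral>x. f x \<partial>M)"
proof -
  let ?c = "(\<integral>x. f x \<partial>M)"
  have "AE x in M. \<forall>k. \<forall>\<^sub>F n in sequentially. birkhoff_sum T f n x / n < ?c + 1 / Suc k"
    unfolding AE_all_countable by (intro allI birkhoff_average_less f) simp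
  moreover have "AE x in M. \<forall>k. \<forall>\<^sub>F n in sequentially. birkhoff_sum T (\<lambda>x. - f x) n x / n
      < (\<integral>x. - f x \<partial>M) + 1 / Suc k"
    unfolding AE_all_countable by (intro allI birkhoff_average_less) (use f in auto)
  ultimately show ?thesis
  proof eventually_elim
    case (elim x)
    show ?case
    proof (rule LIMSEQ_I, goal_cases)
      case (1 e)
      then obtain k where k: "1 / Suc k < e" using nat_approx_posE by (metis of_nat_Suc)
      from elim have "\<forall>\<^sub>F n in sequentially. birkhoff_sum T f n x / n < ?c + 1 / Suc k"
        "\<forall>\<^sub>F n in sequentially. birkhoff_sum T (\<lambda>x. - f x) n x / n
      < (\<integral>x. - f x \<partial>M) + 1 / Suc k" by blast+
      then have "\<forall>\<^sub>F n in sequentially. norm (birkhoff_sum T f n x / n - ?c) < e"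
      proof eventually_elim
        case (elim n)
        then show ?case using k by (simp add: birkhoff_sum_def sum_negf)
      qed
      then show ?case by (simp add: eventually_sequentially)
    qed
  qed
qed

text \<open>Scheffe's argument. For nonnegative f the negative part of the deviation is at most the
  mean, so dominated convergence applies to it. The deviation has integral 0, hence its L1 norm is
  twice the integral of that negative part.\<close>

lemma birkhoff_L1_nonneg:
  fixes f :: "'a \<Rightarrow> real"
  assumes f: "integrable M f" and nn: "\<And>x. 0 \<le> f x"
  shows "(\<lambda>n. \<integral>x. \<bar>birkhoff_sum T f n x / n - (\<integral>x. f x \<partial>M)\<bar> \<partial>M) \<longlonglongrightarrow> 0"
proof -
  let ?c = "(\<integral>x. f x \<partial>M)"
  have [measurable]: "f \<in> borel_measurable M" using f by simp
  have c: "?c \<ge> 0" using nn by simp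
  have pos: "birkhoff_sum T f n x / n \<ge> 0" for n x
    unfolding birkhoff_sum_def by (intro divide_nonneg_nonneg sum_nonneg nn) simp
  have int: "integrable M (\<lambda>x. birkhoff_sum T f n x / n)" for n
    using integrable_birkhoff_sum[OF f] by simp
  have mean: "(\<integral>x. birkhoff_sum T f n x / n \<partial>M) = ?c" if "n > 0" for n
  proof -
    have "(\<integral>x. birkhoff_sum T f n x \<partial>M) = n * ?c"
      unfolding birkhoff_sum_def using f
      by (subst Bochner_Integration.integral_sum) (auto simp: integrable_iter integral_iter)
    then show ?thesis using that by simp
  qed
  have lim: "(\<lambda>n. \<integral>x. max 0 (?c - birkhoff_sum T f n x / n) \<partial>M) \<longlonglongrightarrow> (\<integral>x. max 0 (?c - ?c) \<partial>M)"
  proof (rule integral_dominated_convergence[where w="\<lambda>x. ?c"])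
    show "AE x in M. (\<lambda>n. max 0 (?c - birkhoff_sum T f n x / n)) \<longlonglongrightarrow> max 0 (?c - ?c)"
      using birkhoff_AE[OF f] by eventually_elim (intro tendsto_intros)
    show "AE x in M. norm (max 0 (?c - birkhoff_sum T f n x / n)) \<le> ?c" for n
      using c pos[of n] by (intro AE_I2) (auto simp: max_def)
  qed auto
  have "(\<integral>x. \<bar>birkhoff_sum T f n x / n - ?c\<bar> \<partial>M)
      = 2 * (\<integral>x. max 0 (?c - birkhoff_sum T f n x / n) \<partial>M)" if n: "n > 0" for n
  proof -
    have "(\<integral>x. \<bar>birkhoff_sum T f n x / n - ?c\<bar> \<partial>M) =
      (\<integral>x. 2 * max 0 (?c - birkhoff_sum T f n x / n) + (birkhoff_sum T f n x / n - ?c) \<partial>M)"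
      by (rule Bochner_Integration.integral_cong) (auto simp: max_def)
    also have "\<dots> = (\<integral>x. 2 * max 0 (?c - birkhoff_sum T f n x / n) \<partial>M)
        + (\<integral>x. birkhoff_sum T f n x / n - ?c \<partial>M)"
      using int by (intro Bochner_Integration.integral_add) auto
    also have "(\<integral>x. birkhoff_sum T f n x / n - ?c \<partial>M) = 0"
      using int[of n] mean[OF n] by (subst Bochner_Integration.integral_diff) (auto simp: prob_space)
    finally show ?thesis by simp
  qed
  moreover have "(\<lambda>n. 2 * (\<integral>x. max 0 (?c - birkhoff_sum T f n x / n) \<partial>M)) \<longlonglongrightarrow> 0"
    using tendsto_mult_left[OF lim, of 2] by simp
  ultimately show ?thesis
    by (subst tendsto_cong[of _ "\<lambda>n. 2 * (\<integral>x. max 0 (?c - birkhoff_sum T f n x / n) \<partial>M)"])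
      (auto intro: eventually_mono[OF eventually_gt_at_top[of 0]])
qed

theorem birkhoff_L1:
  fixes f :: "'a \<Rightarrow> real"
  assumes f: "integrable M f"
  shows "(\<lambda>n. \<integral>x. \<bar>birkhoff_sum T f n x / n - (\<integral>x. f x \<partial>M)\<bar> \<partial>M) \<longlonglongrightarrow> 0"
proof -
  define fp where "fp x = max 0 (f x)" for x
  define fm where "fm x = max 0 (- f x)" for x
  have int: "integrable M fp" "integrable M fm" using f by (auto simp: fp_def[abs_def] fm_def[abs_def])
  have f_eq: "f x = fp x - fm x" for x by (auto simp: fp_def fm_def)
  have c: "(\<integral>x. f x \<partial>M) = (\<integral>x. fp x \<partial>M) - (\<integral>x. fm x \<partial>M)"
    unfolding f_eq using int by simp
  have S: "birkhoff_sum T f n x = birkhoff_sum T fp n x - birkhoff_sum T fm n x" for n x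
    by (simp add: birkhoff_sum_def f_eq sum_subtractf)
  let ?I = "\<lambda>f n. \<integral>x. \<bar>birkhoff_sum T f n x / n - (\<integral>x. f x \<partial>M)\<bar> \<partial>M"
  have I: "integrable M (\<lambda>x. \<bar>birkhoff_sum T g n x / n - (\<integral>x. g x \<partial>M)\<bar>)"
    if "integrable M g" for g :: "'a \<Rightarrow> real" and n
    using integrable_birkhoff_sum[OF that] by simp
  have "?I f n \<le> ?I fp n + ?I fm n" for n
  proof -
    have "?I f n \<le> (\<integral>x. \<bar>birkhoff_sum T fp n x / n - (\<integral>x. fp x \<partial>M)\<bar> +
        \<bar>birkhoff_sum T fm n x / n - (\<integral>x. fm x \<partial>M)\<bar> \<partial>M)"
    proof (rule integral_mono)
      show "\<bar>birkhoff_sum T f n x / n - (\<integral>x. f x \<partial>M)\<bar> \<le>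
         \<bar>birkhoff_sum T fp n x / n - (\<integral>x. fp x \<partial>M)\<bar> + \<bar>birkhoff_sum T fm n x / n - (\<integral>x. fm x \<partial>M)\<bar>" for x
        unfolding S c diff_divide_distrib by linarith
    qed (use I[OF f] I[OF int(1)] I[OF int(2)] in auto)
    also have "\<dots> = ?I fp n + ?I fm n"
      by (intro Bochner_Integration.integral_add I int)
    finally show ?thesis .
  qed
  moreover have "(\<lambda>n. ?I fp n + ?I fm n) \<longlonglongrightarrow> 0 + 0"
    by (intro tendsto_add birkhoff_L1_nonneg int) (auto simp: fp_def fm_def)
  ultimately show ?thesis
    by (intro tendsto_sandwich[of "\<lambda>_. 0" "?I f" _ "\<lambda>n. ?I fp n + ?I fm n"]) auto
qed

text \<open>By Fatou, the points that visit \<open>B\<close> infinitely often have measure at least \<open>\<mu>(B)\<close>.\<close>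

lemma AE_infinitely_often:
  assumes B [measurable]: "B \<in> sets M" and pos: "prob B > 0"
  shows "AE x in M. \<exists>\<^sub>\<infinity>i. (T ^^ i) x \<in> B"
proof -
  define P where "P x \<longleftrightarrow> (\<exists>\<^sub>\<infinity>i. (T ^^ i) x \<in> B)" for x
  have [measurable]: "Measurable.pred M P"
    unfolding P_def INFM_nat by measurable
  have "P (T x) \<longleftrightarrow> P x" for x
  proof -
    have "P (T x) \<longleftrightarrow> (\<exists>\<^sub>\<infinity>i. (T ^^ Suc i) x \<in> B)" by (simp add: P_def funpow_swap1)
    also have "\<dots> \<longleftrightarrow> P x" unfolding P_def
      using eventually_sequentially_Suc[of "\<lambda>i. (T ^^ i) x \<notin> B"]
      by (simp add: frequently_def cofinite_eq_sequentially)
    finally show ?thesis .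
  qed
  then have "(AE x in M. P x) \<or> (AE x in M. \<not> P x)" by (intro invariant_set_01) auto
  moreover have "\<not> (AE x in M. \<not> P x)"
  proof
    assume AE: "AE x in M. \<not> P x"
    have "(\<lambda>n. \<integral>x. indicator {x\<in>space M. (T ^^ n) x \<in> B} x \<partial>M) \<longlonglongrightarrow> (\<integral>x. (0::real) \<partial>M)"
    proof (rule integral_dominated_convergence[where w="\<lambda>x. 1"])
      show "AE x in M. (\<lambda>n. indicator {x\<in>space M. (T ^^ n) x \<in> B} x) \<longlonglongrightarrow> (0::real)"
        using AE
      proof eventually_elim
        case (elim x)
        then have "\<forall>\<^sub>F i in sequentially. (T ^^ i) x \<notin> B"
          by (simp add: P_def frequently_def cofinite_eq_sequentially)
        then show ?case
          by (intro tendsto_eventually) (auto elim!: eventually_mono)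
      qed
    qed auto
    then have "(\<lambda>n::nat. prob B) \<longlonglongrightarrow> 0"
      by (simp add: prob_iter)
    then show False using pos by (simp add: LIMSEQ_const_iff)
  qed
  ultimately show ?thesis by (simp add: P_def)
qed

text \<open>The sets decrease in m, and their intersection is null by recurrence.\<close>

lemma prob_no_visit_small:
  assumes B [measurable]: "B \<in> sets M" and pos: "prob B > 0" and e: "e > 0"
  shows "\<exists>m. prob {x \<in> space M. \<forall>i<m. (T ^^ i) x \<notin> B} < e"
proof -
  let ?A = "\<lambda>m. {x \<in> space M. \<forall>i<m. (T ^^ i) x \<notin> B}"
  have "(\<lambda>m. prob (?A m)) \<longlonglongrightarrow> prob (\<Inter>m. ?A m)"
    by (rule finite_Lim_measure_decseq) (auto simp: decseq_def)
  moreover have "prob (\<Inter>m. ?A m) = 0"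
  proof -
    have "AE x in M. x \<notin> (\<Inter>m. ?A m)"
      using AE_infinitely_often[OF B pos]
      by eventually_elim (auto simp: INFM_nat, metis lessI)
    moreover have "(\<Inter>m. ?A m) \<in> sets M" by measurable
    ultimately show ?thesis by (simp add: prob_eq_0)
  qed
  ultimately have "\<forall>\<^sub>F m in sequentially. prob (?A m) < e"
    using e by (auto intro: order_tendstoD)
  then show ?thesis by (auto dest: eventually_happens)
qed

end

section \<open>The barrier function\<close>

text \<open>The cube of the positive part is twice differentiable with Lipschitz second derivative,
  so its second-order expansion has a cubic error. For \<open>w \<ge> 0\<close> the left side is (w
  + \<delta>)^3 minus the nonnegative number \<delta>^3 + |\<delta>|^3; for w < 0 only -|\<delta>|^3
  is left.\<close>

lemma cube_pos_part_taylor: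
  fixes w \<delta> :: real
  shows "(max 0 w)^3 + 3 * (max 0 w)^2 * \<delta> + 3 * max 0 w * \<delta>^2 - \<bar>\<delta>\<bar>^3 \<le> (max 0 (w + \<delta>))^3"
proof (cases "w \<ge> 0")
  case True
  have e: "w^3 + 3 * w^2 * \<delta> + 3 * w * \<delta>^2 = (w + \<delta>)^3 - \<delta>^3"
    by (simp add: power3_eq_cube power2_eq_square algebra_simps)
  have "- (\<delta>^3) \<le> \<bar>\<delta>\<bar>^3" by (simp add: power_abs[symmetric])
  moreover have "\<bar>\<delta>\<bar>^3 = - (\<delta>^3)" "(w + \<delta>)^3 \<le> 0" if "w + \<delta> < 0"
    using that True by (auto simp: abs_if power3_eq_cube mult_nonneg_nonpos2 zero_le_mult_iff mult_le_0_iff)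
  ultimately show ?thesis using True e by (cases "w + \<delta> < 0") (auto simp: max_def)
next
  case False
  have "0 \<le> (max 0 (w + \<delta>))^3" by simp
  moreover have "0 \<le> \<bar>\<delta>\<bar>^3" by simp
  ultimately have "0 - \<bar>\<delta>\<bar>^3 \<le> (max 0 (w + \<delta>))^3" by linarith
  moreover have "max 0 w = 0" using False by simp
  ultimately show ?thesis by simp
qed

definition bump_base :: "real \<Rightarrow> 'b::real_inner \<Rightarrow> real" where
  "bump_base r v = max 0 (r\<^sup>2 - (norm v)\<^sup>2)"

lemma bump_base_nonneg: "0 \<le> bump_base r v"
  by (simp add: bump_base_def)

lemma bump_base_le: "bump_base r v \<le> r\<^sup>2"
  by (simp add: bump_base_def)

lemma bump_base_pos_norm:
  assumes "0 \<le> r" "bump_base r v \<noteq> 0" shows "norm v < r" 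
proof -
  have "(norm v)\<^sup>2 < r\<^sup>2" using assms(2) by (simp add: bump_base_def max_def split: if_splits)
  then show ?thesis using assms(1) by (rule power_less_imp_less_base)
qed

text \<open>Moving from v to v + d changes r^2 - |v|^2 by \<delta> = - 2 (v \<bullet> d) - |d|^2, to
  which the cubic expansion is applied. The error is cubic for small d, which makes it negligible
  after scaling, and only quadratic for large d, so that second moments control it.\<close>

lemma bump_taylor:
  fixes v d :: "'b::real_inner"
  assumes r: "0 \<le> r" "r \<le> 1"
  defines "W \<equiv> bump_base r v"
  shows "W^3 - 6 * W\<^sup>2 * (v \<bullet> d) + (12 * W * (v \<bullet> d)\<^sup>2 - 3 * W\<^sup>2 * (norm d)\<^sup>2)
    - 39 * (norm d)\<^sup>2 * min 1 (norm d) \<le> (bump_base r (v + d))^3"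
proof (cases "W = 0")
  case True
  have "0 \<le> 39 * (norm d)\<^sup>2 * min 1 (norm d)" by simp
  moreover have "0 \<le> (bump_base r (v + d))^3" by (simp add: bump_base_nonneg)
  ultimately have "0 - 39 * (norm d)\<^sup>2 * min 1 (norm d) \<le> (bump_base r (v + d))^3" by linarith
  then show ?thesis unfolding True by simp
next
  case False
  define n where "n = norm d"
  define c where "c = v \<bullet> d"
  have nv: "norm v < r" using False bump_base_pos_norm r unfolding W_def by blast
  have n: "n \<ge> 0" by (simp add: n_def)
  have c: "\<bar>c\<bar> \<le> n"
  proof -
    have "\<bar>c\<bar> \<le> norm v * norm d" unfolding c_def by (rule Cauchy_Schwarz_ineq2)
    also have "\<dots> \<le> 1 * n" unfolding n_def using nv r by (intro mult_right_mono) auto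
    finally show ?thesis by simp
  qed
  have W: "0 \<le> W" "W \<le> 1"
    unfolding W_def using bump_base_nonneg bump_base_le[of r v] power_le_one[OF r, of 2] by (auto intro: order_trans)
  have W2: "0 \<le> W\<^sup>2" "W\<^sup>2 \<le> 1" "W^3 \<le> 1" using W by (auto simp: power_le_one)
  define \<delta> where "\<delta> = - 2 * c - n\<^sup>2"
  have "(norm (v + d))\<^sup>2 = (norm v)\<^sup>2 + 2 * c + n\<^sup>2"
    unfolding n_def c_def by (simp add: power2_norm_eq_inner inner_simps inner_commute)
  then have sh: "r\<^sup>2 - (norm (v + d))\<^sup>2 = (r\<^sup>2 - (norm v)\<^sup>2) + \<delta>" by (simp add: \<delta>_def)
  have main: "W^3 + 3 * W\<^sup>2 * \<delta> + 3 * W * \<delta>\<^sup>2 - \<bar>\<delta>\<bar>^3 \<le> (bump_base r (v + d))^3"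
    using cube_pos_part_taylor[of "r\<^sup>2 - (norm v)\<^sup>2" \<delta>] unfolding W_def bump_base_def sh .
  have goal: "W^3 - 6 * W\<^sup>2 * c + (12 * W * c\<^sup>2 - 3 * W\<^sup>2 * n\<^sup>2)
    - 39 * n\<^sup>2 * min 1 n \<le> (bump_base r (v + d))^3"
  proof (cases "n \<le> 1")
    \<comment> \<open>The constant 39 is 27 from |\<delta>|^3 with |\<delta>| \<le> 3n, plus 12 from
      the mixed term of 3 W \<delta>^2.\<close>
    case True
    have n2: "n\<^sup>2 \<le> n" using True n by (simp add: power2_eq_square mult_left_le)
    have "\<bar>\<delta>\<bar> \<le> 3 * n" using c n2 unfolding \<delta>_def by (smt (verit) zero_le_power2)
    then have "\<bar>\<delta>\<bar>^3 \<le> (3 * n)^3" by (intro power_mono) auto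
    then have d3: "\<bar>\<delta>\<bar>^3 \<le> 27 * n^3" by (simp add: power_mult_distrib)
    have "\<bar>W * c * n\<^sup>2\<bar> \<le> 1 * n * n\<^sup>2" unfolding abs_mult using W c by (intro mult_mono) auto
    then have "- (n^3) \<le> W * c * n\<^sup>2" by (simp add: power3_eq_cube power2_eq_square)
    moreover have "3 * W * \<delta>\<^sup>2 = 12 * W * c\<^sup>2 + 12 * (W * c * n\<^sup>2) + 3 * W * (n\<^sup>2)\<^sup>2"
      by (simp add: \<delta>_def power2_eq_square algebra_simps)
    moreover have "0 \<le> 3 * W * (n\<^sup>2)\<^sup>2" using W by simp
    moreover have "3 * W\<^sup>2 * \<delta> = - 6 * W\<^sup>2 * c - 3 * W\<^sup>2 * n\<^sup>2" by (simp add: \<delta>_def algebra_simps)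
    moreover have "n\<^sup>2 * min 1 n = n^3" using True by (simp add: power2_eq_square power3_eq_cube)
    ultimately show ?thesis using main d3 by linarith
  next
    \<comment> \<open>For n > 1 the positive terms add up to at most (1 + 6 + 12) n^2, so the left
      side is negative and the nonnegativity of the bump is enough.\<close>
    case False
    have n2: "n \<le> n\<^sup>2" "1 \<le> n\<^sup>2" using False n by (auto simp: power2_eq_square mult_le_cancel_left1 less_1_mult intro: less_imp_le)
    have "\<bar>W\<^sup>2 * c\<bar> \<le> 1 * n" unfolding abs_mult using W2 c by (intro mult_mono) auto
    then have "- (W\<^sup>2 * c) \<le> n" by linarith
    moreover have "W * c\<^sup>2 \<le> 1 * n\<^sup>2" using W c by (intro mult_mono) (auto simp: abs_le_square_iff[symmetric])
    moreover have "0 \<le> W\<^sup>2 * n\<^sup>2" by simp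
    moreover have "0 \<le> (bump_base r (v + d))^3" by (simp add: bump_base_nonneg)
    moreover have "n\<^sup>2 * min 1 n = n\<^sup>2" using False by simp
    ultimately show ?thesis using n2 W2 by linarith
  qed
  then show ?thesis unfolding n_def c_def .
qed

text \<open>Here D is the sum over a block of L steps, and the centre of the ball moves by
  \<open>(\<epsilon>\<^sup>2 * L) *\<^sub>R a\<close> meanwhile. In the second-order terms the
  displacement d may be replaced with \<epsilon> D: each of the two squares changes by at most 2
  \<epsilon>^3 Z^2, and the coefficients 12 and 3 turn this into the 30 in the error. The 39 comes
  from \<open>bump_taylor\<close> with |d| \<le> \<epsilon> Z.\<close>

lemma bump_block:
  fixes v D a :: "'b::real_inner" and \<epsilon> L :: real
  assumes r: "0 \<le> r" "r \<le> 1" and e: "0 < \<epsilon>" "\<epsilon> \<le> 1" and L: "0 \<le> L"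
  defines "W \<equiv> bump_base r v" and "Z \<equiv> norm D + L * norm a"
  shows "W^3 - 6 * \<epsilon> * (W\<^sup>2 * (v \<bullet> D)) + 6 * \<epsilon>\<^sup>2 * L * (W\<^sup>2 * (v \<bullet> a))
    + \<epsilon>\<^sup>2 * (12 * W * (v \<bullet> D)\<^sup>2 - 3 * W\<^sup>2 * (norm D)\<^sup>2)
    - \<epsilon>\<^sup>2 * (Z\<^sup>2 * (30 * \<epsilon> + 39 * min 1 (\<epsilon> * Z)))
    \<le> (bump_base r (v + (\<epsilon> *\<^sub>R D - (\<epsilon>\<^sup>2 * L) *\<^sub>R a)))^3"
proof (cases "W = 0")
  case True
  have "0 \<le> Z" using L by (simp add: Z_def)
  then have "0 \<le> \<epsilon>\<^sup>2 * (Z\<^sup>2 * (30 * \<epsilon> + 39 * min 1 (\<epsilon> * Z)))"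
    using e by (intro mult_nonneg_nonneg) auto
  moreover have "0 \<le> (bump_base r (v + (\<epsilon> *\<^sub>R D - (\<epsilon>\<^sup>2 * L) *\<^sub>R a)))^3" by (simp add: bump_base_nonneg)
  ultimately have "0 - \<epsilon>\<^sup>2 * (Z\<^sup>2 * (30 * \<epsilon> + 39 * min 1 (\<epsilon> * Z)))
    \<le> (bump_base r (v + (\<epsilon> *\<^sub>R D - (\<epsilon>\<^sup>2 * L) *\<^sub>R a)))^3" by linarith
  then show ?thesis unfolding True by simp
next
  case False
  define d where "d = \<epsilon> *\<^sub>R D - (\<epsilon>\<^sup>2 * L) *\<^sub>R a"
  have nv: "norm v \<le> 1" using False bump_base_pos_norm r unfolding W_def by fastforce
  have W: "0 \<le> W" "W \<le> 1"
    unfolding W_def using bump_base_nonneg bump_base_le[of r v] power_le_one[OF r, of 2] by (auto intro: order_trans)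
  have W2: "0 \<le> W\<^sup>2" "W\<^sup>2 \<le> 1" using W by (auto simp: power_le_one)
  have Z: "0 \<le> Z" "norm D \<le> Z" "L * norm a \<le> Z" using L by (auto simp: Z_def)
  have e2: "\<epsilon>\<^sup>2 \<le> \<epsilon>" using e by (simp add: power2_eq_square mult_left_le)
  have nd: "norm d \<le> \<epsilon> * Z"
  proof -
    have "norm d \<le> norm (\<epsilon> *\<^sub>R D) + norm ((\<epsilon>\<^sup>2 * L) *\<^sub>R a)" unfolding d_def by (rule norm_triangle_ineq4)
    also have "\<dots> = \<epsilon> * norm D + \<epsilon>\<^sup>2 * (L * norm a)" using e L by simp
    also have "\<dots> \<le> \<epsilon> * norm D + \<epsilon> * (L * norm a)" using e2 L by (intro add_left_mono mult_right_mono) auto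
    finally show ?thesis by (simp add: Z_def algebra_simps)
  qed
  have diff: "norm (d - \<epsilon> *\<^sub>R D) \<le> \<epsilon>\<^sup>2 * Z"
  proof -
    have "norm (d - \<epsilon> *\<^sub>R D) = \<epsilon>\<^sup>2 * (L * norm a)" using L by (simp add: d_def)
    also have "\<dots> \<le> \<epsilon>\<^sup>2 * Z" using Z by (intro mult_left_mono) auto
    finally show ?thesis .
  qed
  have sum: "norm (d + \<epsilon> *\<^sub>R D) \<le> 2 * \<epsilon> * Z"
  proof -
    have "norm (d + \<epsilon> *\<^sub>R D) \<le> norm d + \<epsilon> * norm D" using norm_triangle_ineq[of d "\<epsilon> *\<^sub>R D"] e by simp
    also have "\<dots> \<le> \<epsilon> * Z + \<epsilon> * Z" using nd e Z by (intro add_mono mult_left_mono) auto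
    finally show ?thesis by (simp add: mult_ac)
  qed
  have vb: "\<bar>v \<bullet> z\<bar> \<le> norm z" for z
    using order_trans[OF Cauchy_Schwarz_ineq2[of v z] mult_right_mono[OF nv norm_ge_zero[of z]]] by simp
  have prod: "norm (d - \<epsilon> *\<^sub>R D) * norm (d + \<epsilon> *\<^sub>R D) \<le> 2 * (\<epsilon>^3 * Z\<^sup>2)"
  proof -
    have "norm (d - \<epsilon> *\<^sub>R D) * norm (d + \<epsilon> *\<^sub>R D) \<le> (\<epsilon>\<^sup>2 * Z) * (2 * \<epsilon> * Z)"
      using diff sum Z e by (intro mult_mono) auto
    then show ?thesis by (simp add: power2_eq_square power3_eq_cube algebra_simps)
  qed
  \<comment> \<open>Both comparisons factor a difference of squares: one factor is of order
    \<epsilon>^2, the other of order \<epsilon>.\<close>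
  have q1: "\<bar>(v \<bullet> d)\<^sup>2 - \<epsilon>\<^sup>2 * (v \<bullet> D)\<^sup>2\<bar> \<le> 2 * (\<epsilon>^3 * Z\<^sup>2)"
  proof -
    have "(v \<bullet> d)\<^sup>2 - \<epsilon>\<^sup>2 * (v \<bullet> D)\<^sup>2 = (v \<bullet> (d - \<epsilon> *\<^sub>R D)) * (v \<bullet> (d + \<epsilon> *\<^sub>R D))"
      by (simp add: inner_simps power2_eq_square algebra_simps)
    also have "\<bar>\<dots>\<bar> \<le> norm (d - \<epsilon> *\<^sub>R D) * norm (d + \<epsilon> *\<^sub>R D)"
      unfolding abs_mult by (intro mult_mono vb) auto
    finally show ?thesis using prod by simp
  qed
  have q2: "\<bar>(norm d)\<^sup>2 - \<epsilon>\<^sup>2 * (norm D)\<^sup>2\<bar> \<le> 2 * (\<epsilon>^3 * Z\<^sup>2)"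
  proof -
    have "(norm d)\<^sup>2 - \<epsilon>\<^sup>2 * (norm D)\<^sup>2 = (d - \<epsilon> *\<^sub>R D) \<bullet> (d + \<epsilon> *\<^sub>R D)"
      unfolding power2_norm_eq_inner by (simp add: inner_simps power2_eq_square algebra_simps inner_commute)
    also have "\<bar>\<dots>\<bar> \<le> norm (d - \<epsilon> *\<^sub>R D) * norm (d + \<epsilon> *\<^sub>R D)" by (rule Cauchy_Schwarz_ineq2)
    finally show ?thesis using prod by simp
  qed
  have t1: "W * (\<epsilon>\<^sup>2 * (v \<bullet> D)\<^sup>2) - 2 * (\<epsilon>^3 * Z\<^sup>2) \<le> W * (v \<bullet> d)\<^sup>2"
  proof -
    have "W * (\<epsilon>\<^sup>2 * (v \<bullet> D)\<^sup>2 - (v \<bullet> d)\<^sup>2) \<le> W * (2 * (\<epsilon>^3 * Z\<^sup>2))" using W q1 by (intro mult_left_mono) auto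
    also have "\<dots> \<le> 1 * (2 * (\<epsilon>^3 * Z\<^sup>2))" using W e by (intro mult_right_mono) auto
    finally show ?thesis by (simp add: algebra_simps)
  qed
  have t2: "W\<^sup>2 * (norm d)\<^sup>2 \<le> W\<^sup>2 * (\<epsilon>\<^sup>2 * (norm D)\<^sup>2) + 2 * (\<epsilon>^3 * Z\<^sup>2)"
  proof -
    have "W\<^sup>2 * ((norm d)\<^sup>2 - \<epsilon>\<^sup>2 * (norm D)\<^sup>2) \<le> W\<^sup>2 * (2 * (\<epsilon>^3 * Z\<^sup>2))" using W2 q2 by (intro mult_left_mono) auto
    also have "\<dots> \<le> 1 * (2 * (\<epsilon>^3 * Z\<^sup>2))" using W2 e by (intro mult_right_mono) auto
    finally show ?thesis by (simp add: algebra_simps)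
  qed
  have t3: "(norm d)\<^sup>2 * min 1 (norm d) \<le> (\<epsilon> * Z)\<^sup>2 * min 1 (\<epsilon> * Z)"
    using nd by (intro mult_mono power_mono) auto
  have vd: "v \<bullet> d = \<epsilon> * (v \<bullet> D) - \<epsilon>\<^sup>2 * L * (v \<bullet> a)" by (simp add: d_def inner_simps)
  have t4: "W\<^sup>2 * (v \<bullet> d) = \<epsilon> * (W\<^sup>2 * (v \<bullet> D)) - \<epsilon>\<^sup>2 * L * (W\<^sup>2 * (v \<bullet> a))"
    unfolding vd by (simp add: algebra_simps)
  have *: "\<epsilon>\<^sup>2 * (12 * W * (v \<bullet> D)\<^sup>2 - 3 * W\<^sup>2 * (norm D)\<^sup>2) = 12 * (W * (\<epsilon>\<^sup>2 * (v \<bullet> D)\<^sup>2)) - 3 * (W\<^sup>2 * (\<epsilon>\<^sup>2 * (norm D)\<^sup>2))"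
    "\<epsilon>\<^sup>2 * (Z\<^sup>2 * (30 * \<epsilon> + 39 * m)) = 30 * (\<epsilon>^3 * Z\<^sup>2) + 39 * ((\<epsilon> * Z)\<^sup>2 * m)" for m
    by (simp_all add: power2_eq_square power3_eq_cube algebra_simps)
  show ?thesis
    using bump_taylor[OF r, of v d] t1 t2 t3 t4 unfolding * W_def[symmetric] d_def[symmetric] by linarith
qed

text \<open>This separates the products of coordinates of the block sum D from coefficients that
  depend only on the position v before the block. The covariance can then be substituted entry by
  entry.\<close>

lemma bump_quadratic_expand:
  fixes v D :: "real ^ 'n"
  shows "12 * W * (v \<bullet> D)\<^sup>2 - 3 * W\<^sup>2 * (norm D)\<^sup>2 =
    (\<Sum>i\<in>UNIV. \<Sum>l\<in>UNIV. (12 * W * v $ i * v $ l - (if i = l then 3 * W\<^sup>2 else 0)) * (D $ i * D $ l))"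
proof -
  have "(v \<bullet> D)\<^sup>2 = (\<Sum>i\<in>UNIV. \<Sum>l\<in>UNIV. (v $ i * v $ l) * (D $ i * D $ l))"
    by (simp add: power2_eq_square inner_vec_def sum_product mult_ac)
  then have 1: "12 * W * (v \<bullet> D)\<^sup>2 = (\<Sum>i\<in>UNIV. \<Sum>l\<in>UNIV. 12 * W * v $ i * v $ l * (D $ i * D $ l))"
    by (simp add: sum_distrib_left mult_ac)
  have "(norm D)\<^sup>2 = (\<Sum>i\<in>UNIV. D $ i * D $ i)"
    by (simp add: power2_norm_eq_inner inner_vec_def)
  then have 2: "3 * W\<^sup>2 * (norm D)\<^sup>2 = (\<Sum>i\<in>UNIV. \<Sum>l\<in>UNIV. (if i = l then 3 * W\<^sup>2 else 0) * (D $ i * D $ l))"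
    by (simp add: sum_distrib_left if_distrib[of "\<lambda>z. z * _"] sum.delta cong: if_cong)
  show ?thesis unfolding 1 2 by (simp add: sum_subtractf left_diff_distrib)
qed

section \<open>Integrability of products\<close>

lemma (in prob_space) integrable_bounded_mult:
  fixes g h :: "'a \<Rightarrow> real"
  assumes "integrable M g" "h \<in> borel_measurable M" "\<And>x. \<bar>h x\<bar> \<le> C"
  shows "integrable M (\<lambda>x. h x * g x)"
proof (rule Bochner_Integration.integrable_bound[of _ "\<lambda>x. C * g x"])
  have "\<bar>h x * g x\<bar> \<le> \<bar>C * g x\<bar>" for x
    using order_trans[OF assms(3)[of x] abs_ge_self] by (simp add: abs_mult mult_right_mono)
  then show "AE x in M. norm (h x * g x) \<le> norm (C * g x)" by simp
qed (use assms in auto)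

lemma (in prob_space) integrable_mult_L2:
  fixes g h :: "'a \<Rightarrow> real"
  assumes "g \<in> borel_measurable M" "h \<in> borel_measurable M"
    "integrable M (\<lambda>x. (g x)\<^sup>2)" "integrable M (\<lambda>x. (h x)\<^sup>2)"
  shows "integrable M (\<lambda>x. g x * h x)"
proof (rule Bochner_Integration.integrable_bound[of _ "\<lambda>x. (g x)\<^sup>2 + (h x)\<^sup>2"])
  have "\<bar>a * b\<bar> \<le> a\<^sup>2 + b\<^sup>2" for a b :: real
  proof -
    have "\<bar>a\<bar> * \<bar>b\<bar> \<le> 2 * \<bar>a\<bar> * \<bar>b\<bar>" by simp
    also have "\<dots> \<le> a\<^sup>2 + b\<^sup>2" using sum_squares_bound[of "\<bar>a\<bar>" "\<bar>b\<bar>"] by simp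
    finally show ?thesis by (simp add: abs_mult)
  qed
  then show "AE x in M. norm (g x * h x) \<le> norm ((g x)\<^sup>2 + (h x)\<^sup>2)" by auto
qed (use assms in auto)

section \<open>Martingale cocycles\<close>

lemma borel_measurable_vec_nth [measurable (raw)]:
  fixes f :: "'a \<Rightarrow> real ^ 'n"
  assumes "f \<in> borel_measurable M"
  shows "(\<lambda>x. f x $ i) \<in> borel_measurable M"
  by (rule measurable_compose[OF assms borel_measurable_continuous_onI]) (intro continuous_intros)

text \<open>\<open>H k\<close> is the past strictly before time k: it makes the increments at times
  0, ..., k - 1 measurable. \<open>orth\<close> expresses that the conditional expectation vanishes,
  tested against every h with integrable product. Bounded h would be too few, because in the
  second-moment computation h contains an earlier partial sum as a factor.\<close>

locale martingale_cocycle = ergodic_mps M T for M :: "'a measure" and T +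
  fixes \<Phi> :: "'a \<Rightarrow> real ^ 'n" and H :: "nat \<Rightarrow> 'a measure"
  assumes subalg: "subalgebra M (H k)"
    and H_Suc: "sets (H k) \<subseteq> sets (H (Suc k))"
    and adapted: "(\<lambda>x. \<Phi> ((T ^^ k) x)) \<in> borel_measurable (H (Suc k))"
    and square_int: "integrable M (\<lambda>x. (norm (\<Phi> x))\<^sup>2)"
    and orth: "h \<in> borel_measurable (H k) \<Longrightarrow> integrable M (\<lambda>x. h x * \<Phi> ((T ^^ k) x) $ i) \<Longrightarrow>
      (\<integral>x. h x * \<Phi> ((T ^^ k) x) $ i \<partial>M) = 0"
    and nondeg: "a \<noteq> 0 \<Longrightarrow> \<not> (AE x in M. a \<bullet> \<Phi> x = 0)"
begin

lemma H_mono: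
  assumes "j \<le> k" shows "subalgebra (H k) (H j)"
proof -
  have "sets (H j) \<subseteq> sets (H k)" by (rule lift_Suc_mono_le[of "\<lambda>k. sets (H k)", OF H_Suc assms])
  then show ?thesis using subalg by (simp add: subalgebra_def)
qed

lemma Phi_measurable [measurable]: "\<Phi> \<in> borel_measurable M"
  using measurable_from_subalg[OF subalg adapted[of 0]] by simp

definition partial_sum :: "nat \<Rightarrow> nat \<Rightarrow> 'a \<Rightarrow> real ^ 'n" where
  "partial_sum k L x = (\<Sum>j<L. \<Phi> ((T ^^ (k + j)) x))"

lemma partial_sum_eq: "partial_sum k L x = birkhoff_sum T \<Phi> L ((T ^^ k) x)"
  unfolding partial_sum_def birkhoff_sum_def by (simp add: funpow_add add.commute)

lemma birkhoff_sum_eq_partial_sum: "birkhoff_sum T \<Phi> k x = partial_sum 0 k x"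
  by (simp add: partial_sum_eq)

lemma adapted_partial_sum: "partial_sum k L \<in> borel_measurable (H (k + L))"
  unfolding partial_sum_def
  by (intro borel_measurable_sum measurable_from_subalg[OF H_mono adapted]) auto

lemma partial_sum_measurable [measurable]: "partial_sum k L \<in> borel_measurable M"
  by (rule measurable_from_subalg[OF subalg adapted_partial_sum])

lemma Phi_nth_sq: "integrable M (\<lambda>x. (\<Phi> ((T ^^ k) x) $ i)\<^sup>2)"
proof -
  have "integrable M (\<lambda>x. (\<Phi> x $ i)\<^sup>2)"
  proof (rule Bochner_Integration.integrable_bound[OF square_int])
    show "AE x in M. norm ((\<Phi> x $ i)\<^sup>2) \<le> norm ((norm (\<Phi> x))\<^sup>2)"
      using component_le_norm_cart by (auto simp: abs_le_square_iff[symmetric])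
  qed measurable
  then show ?thesis by (rule integrable_iter)
qed

lemma partial_sum_nth_sq: "integrable M (\<lambda>x. (partial_sum k L x $ i)\<^sup>2)"
proof (induction L)
  case 0
  then show ?case by (simp add: partial_sum_def)
next
  case (Suc L)
  have "integrable M (\<lambda>x. (partial_sum k L x $ i)\<^sup>2 + (\<Phi> ((T ^^ (k + L)) x) $ i)\<^sup>2 + 2 * (partial_sum k L x $ i * \<Phi> ((T ^^ (k + L)) x) $ i))"
    by (intro Bochner_Integration.integrable_add Suc Phi_nth_sq integrable_mult_right integrable_mult_L2) measurable
  then show ?case by (simp add: partial_sum_def power2_sum mult.assoc)
qed

lemma partial_sum_norm_sq: "integrable M (\<lambda>x. (norm (partial_sum k L x))\<^sup>2)"
proof -
  have "(norm v)\<^sup>2 = (\<Sum>i\<in>UNIV. (v $ i)\<^sup>2)" for v :: "real ^ 'n"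
    unfolding power2_norm_eq_inner by (simp add: inner_vec_def power2_eq_square)
  then show ?thesis using partial_sum_nth_sq by simp
qed

lemma integrable_square_imp:
  fixes g :: "'a \<Rightarrow> real"
  assumes "g \<in> borel_measurable M" "integrable M (\<lambda>x. (g x)\<^sup>2)" shows "integrable M g"
  using integrable_mult_L2[OF assms(1) _ assms(2), of "\<lambda>x. 1"] by simp

text \<open>Every increment of the block comes at time k or later, so \<open>orth\<close> applies to
  it with h read as a function of its larger past. This removes the first-order term of the barrier
  expansion.\<close>

lemma integral_bounded_times_partial_sum:
  assumes h: "h \<in> borel_measurable (H k)" and C: "\<And>x. \<bar>h x\<bar> \<le> C"
  shows "(\<integral>x. h x * partial_sum k L x $ i \<partial>M) = 0"
proof -
  note [measurable] = measurable_from_subalg[OF subalg h]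
  have int: "integrable M (\<lambda>x. h x * \<Phi> ((T ^^ (k + j)) x) $ i)" for j
    by (rule integrable_bounded_mult[OF integrable_square_imp[OF _ Phi_nth_sq] _ C]) measurable
  have "(\<integral>x. h x * \<Phi> ((T ^^ (k + j)) x) $ i \<partial>M) = 0" for j
    by (intro orth int measurable_from_subalg[OF H_mono h]) simp
  then show ?thesis
    unfolding partial_sum_def using int by (simp add: sum_distrib_left)
qed

text \<open>Induction on the block length: the new increment is orthogonal to h times the preceding
  partial sum, so both mixed terms vanish and only the product of the increment with itself is
  added.\<close>

lemma integral_bounded_times_partial_sum_product:
  assumes h: "h \<in> borel_measurable (H k)" and C: "\<And>x. \<bar>h x\<bar> \<le> C"
  shows "(\<integral>x. h x * (partial_sum k L x $ i * partial_sum k L x $ l) \<partial>M)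
    = (\<Sum>j<L. \<integral>x. h x * (\<Phi> ((T ^^ (k + j)) x) $ i * \<Phi> ((T ^^ (k + j)) x) $ l) \<partial>M)"
proof (induction L)
  case 0
  then show ?case by (simp add: partial_sum_def)
next
  case (Suc L)
  note [measurable] = measurable_from_subalg[OF subalg h]
  let ?D = "partial_sum k L" and ?y = "\<lambda>x. \<Phi> ((T ^^ (k + L)) x)"
  have int: "integrable M (\<lambda>x. h x * (?D x $ i * ?D x $ l))" "integrable M (\<lambda>x. h x * (?D x $ i * ?y x $ l))"
    "integrable M (\<lambda>x. h x * (?D x $ l * ?y x $ i))" "integrable M (\<lambda>x. h x * (?y x $ i * ?y x $ l))"
    by (rule integrable_bounded_mult[OF integrable_mult_L2 _ C]; (rule partial_sum_nth_sq Phi_nth_sq | measurable))+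
  have cross: "(\<integral>x. h x * (?D x $ i * ?y x $ l) \<partial>M) = 0"
    if "integrable M (\<lambda>x. h x * (?D x $ i * ?y x $ l))" for i l
  proof -
    have "(\<integral>x. (h x * ?D x $ i) * ?y x $ l \<partial>M) = 0"
    proof (rule orth)
      show "(\<lambda>x. h x * ?D x $ i) \<in> borel_measurable (H (k + L))"
        by (intro borel_measurable_times borel_measurable_vec_nth adapted_partial_sum
            measurable_from_subalg[OF H_mono h]) simp
    qed (use that in \<open>simp add: mult.assoc\<close>)
    then show ?thesis by (simp add: mult.assoc)
  qed
  have "(\<integral>x. h x * (partial_sum k (Suc L) x $ i * partial_sum k (Suc L) x $ l) \<partial>M)
    = (\<integral>x. h x * (?D x $ i * ?D x $ l) + h x * (?D x $ i * ?y x $ l) + h x * (?D x $ l * ?y x $ i)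
        + h x * (?y x $ i * ?y x $ l) \<partial>M)"
    by (rule Bochner_Integration.integral_cong) (auto simp: partial_sum_def algebra_simps)
  also have "\<dots> = (\<integral>x. h x * (?D x $ i * ?D x $ l) \<partial>M) + (\<integral>x. h x * (?y x $ i * ?y x $ l) \<partial>M)"
    using int cross[OF int(2)] cross[OF int(3)] by simp
  finally show ?case using Suc by simp
qed

section \<open>The covariance form and its comparison with block products\<close>

definition covariance :: "'n \<Rightarrow> 'n \<Rightarrow> real" where
  "covariance i l = (\<integral>x. \<Phi> x $ i * \<Phi> x $ l \<partial>M)"

lemma Phi_product_int: "integrable M (\<lambda>x. \<Phi> x $ i * \<Phi> x $ l)"
  using Phi_nth_sq[of 0] by (intro integrable_mult_L2) auto

lemma covariance_quadratic: "(\<Sum>i\<in>UNIV. \<Sum>l\<in>UNIV. v $ i * v $ l * covariance i l) = (\<integral>x. (v \<bullet> \<Phi> x)\<^sup>2 \<partial>M)"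
proof -
  have "(v \<bullet> \<Phi> x)\<^sup>2 = (\<Sum>i\<in>UNIV. \<Sum>l\<in>UNIV. v $ i * v $ l * (\<Phi> x $ i * \<Phi> x $ l))" for x
    by (simp add: power2_eq_square inner_vec_def sum_product mult_ac)
  then show ?thesis
    unfolding covariance_def using Phi_product_int by simp
qed

lemma inner_Phi_sq_int: "integrable M (\<lambda>x. (v \<bullet> \<Phi> x)\<^sup>2)"
proof -
  have "(v \<bullet> \<Phi> x)\<^sup>2 = (\<Sum>i\<in>UNIV. \<Sum>l\<in>UNIV. v $ i * v $ l * (\<Phi> x $ i * \<Phi> x $ l))" for x
    by (simp add: power2_eq_square inner_vec_def sum_product mult_ac)
  then show ?thesis using Phi_product_int by simp
qed

text \<open>The form is continuous, so it has a minimum on the compact unit sphere. The minimum is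
  positive, since the integral of the square of a \<bullet> \<Phi> vanishes only if \<Phi> lies
  almost surely in the hyperplane orthogonal to a. Homogeneity extends the bound to all v.\<close>

lemma covariance_pos_definite:
  "\<exists>\<kappa>>0. \<forall>v. \<kappa> * (norm v)\<^sup>2 \<le> (\<Sum>i\<in>UNIV. \<Sum>l\<in>UNIV. v $ i * v $ l * covariance i l)"
proof -
  define q where "q v = (\<Sum>i\<in>UNIV. \<Sum>l\<in>UNIV. v $ i * v $ l * covariance i l)" for v
  have cont: "continuous_on (sphere 0 1) q" unfolding q_def by (intro continuous_intros)
  have "sphere (0 :: real ^ 'n) 1 \<noteq> {}" by simp
  then obtain a where a: "a \<in> sphere 0 1" "\<And>v. v \<in> sphere 0 1 \<Longrightarrow> q a \<le> q v"
    using continuous_attains_inf[OF compact_sphere _ cont] by blast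
  have "a \<noteq> 0" using a by auto
  then have "\<not> (AE x in M. (a \<bullet> \<Phi> x)\<^sup>2 = 0)" using nondeg by simp
  then have "q a \<noteq> 0"
    unfolding q_def covariance_quadratic using integral_nonneg_eq_0_iff_AE[OF inner_Phi_sq_int[of a]] by simp
  moreover have "q a \<ge> 0" unfolding q_def covariance_quadratic by simp
  ultimately have "q a > 0" by simp
  moreover have "q a * (norm v)\<^sup>2 \<le> q v" for v
  proof (cases "v = 0")
    case True
    then show ?thesis by (simp add: q_def)
  next
    case False
    have "q a \<le> q (v /\<^sub>R norm v)" using False by (intro a) simp
    also have "\<dots> = q v / (norm v)\<^sup>2"
      unfolding q_def sum_divide_distrib by (simp add: power2_eq_square divide_inverse mult_ac)
    finally show ?thesis using False by (simp add: field_simps)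
  qed
  ultimately show ?thesis unfolding q_def by blast
qed

text \<open>The L1 distance between block averages of the products and their means. By invariance of
  the measure it also measures the error for blocks that start at any later time.\<close>

definition ergodic_error :: "nat \<Rightarrow> real" where
  "ergodic_error L = (\<Sum>i\<in>UNIV. \<Sum>l\<in>UNIV.
     \<integral>x. \<bar>birkhoff_sum T (\<lambda>x. \<Phi> x $ i * \<Phi> x $ l) L x / L - covariance i l\<bar> \<partial>M)"

lemma ergodic_error_tendsto: "ergodic_error \<longlonglongrightarrow> 0"
proof -
  have "ergodic_error \<longlonglongrightarrow> (\<Sum>i\<in>(UNIV :: 'n set). \<Sum>l\<in>(UNIV :: 'n set). 0)"
    unfolding ergodic_error_def covariance_def by (intro tendsto_sum birkhoff_L1 Phi_product_int)
  then show ?thesis by simp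
qed

text \<open>The conditional covariance of a single increment need not be constant. After the mixed
  terms are dropped, however, the block contributes L times a Birkhoff average along the shifted
  orbit. Replacing this average with its mean costs at most C times its L1 error in each
  entry.\<close>

lemma integral_quadratic_ge:
  fixes c :: "'n \<Rightarrow> 'n \<Rightarrow> 'a \<Rightarrow> real"
  assumes c: "\<And>i l. c i l \<in> borel_measurable (H k)" and C: "\<And>i l x. \<bar>c i l x\<bar> \<le> C" and L: "L > 0"
  shows "L * (\<integral>x. (\<Sum>i\<in>UNIV. \<Sum>l\<in>UNIV. c i l x * covariance i l) \<partial>M) - L * C * ergodic_error L
    \<le> (\<integral>x. (\<Sum>i\<in>UNIV. \<Sum>l\<in>UNIV. c i l x * (partial_sum k L x $ i * partial_sum k L x $ l)) \<partial>M)"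
proof -
  note [measurable] = measurable_from_subalg[OF subalg c]
  define f where "f i l x = \<Phi> x $ i * \<Phi> x $ l" for i l x
  have f: "integrable M (f i l)" for i l unfolding f_def[abs_def] by (rule Phi_product_int)
  let ?E = "\<lambda>i l. \<integral>x. \<bar>birkhoff_sum T (f i l) L x / L - covariance i l\<bar> \<partial>M"
  let ?D = "partial_sum k L"
  have D_int: "integrable M (\<lambda>x. c i l x * (?D x $ i * ?D x $ l))" for i l
    by (rule integrable_bounded_mult[OF integrable_mult_L2 _ C]; (rule partial_sum_nth_sq | measurable))
  have c_int: "integrable M (c i l)" for i l
    using integrable_bounded_mult[of "\<lambda>_. 1" "c i l", OF _ _ C] by simp
  have "L * (\<integral>x. c i l x * covariance i l \<partial>M) - L * C * ?E i l
      \<le> (\<integral>x. c i l x * (?D x $ i * ?D x $ l) \<partial>M)" for i l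
  proof -
    let ?B = "\<lambda>x. birkhoff_sum T (f i l) L x / L"
    have Bk: "integrable M (\<lambda>x. ?B ((T ^^ k) x))"
      using integrable_iter[OF integrable_birkhoff_sum[OF f]] by simp
    have fj: "integrable M (\<lambda>x. c i l x * f i l ((T ^^ (k + j)) x))" for j
      by (rule integrable_bounded_mult[OF integrable_iter[OF f] _ C]) measurable
    have "(\<integral>x. c i l x * (?D x $ i * ?D x $ l) \<partial>M) = (\<Sum>j<L. \<integral>x. c i l x * f i l ((T ^^ (k + j)) x) \<partial>M)"
      unfolding f_def by (rule integral_bounded_times_partial_sum_product[OF c C])
    also have "\<dots> = (\<integral>x. (\<Sum>j<L. c i l x * f i l ((T ^^ (k + j)) x)) \<partial>M)"
      using fj by simp
    also have "\<dots> = (\<integral>x. L * (c i l x * ?B ((T ^^ k) x)) \<partial>M)"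
      using L by (intro Bochner_Integration.integral_cong)
        (simp_all add: birkhoff_sum_def sum_distrib_left[symmetric] funpow_add add.commute)
    also have "\<dots> = L * (\<integral>x. c i l x * ?B ((T ^^ k) x) \<partial>M)" by simp
    finally have eq: "(\<integral>x. c i l x * (?D x $ i * ?D x $ l) \<partial>M) = L * (\<integral>x. c i l x * ?B ((T ^^ k) x) \<partial>M)" .
    have "(\<integral>x. c i l x * covariance i l - C * \<bar>?B ((T ^^ k) x) - covariance i l\<bar> \<partial>M)
      \<le> (\<integral>x. c i l x * ?B ((T ^^ k) x) \<partial>M)"
    proof (rule integral_mono)
      show "c i l x * covariance i l - C * \<bar>?B ((T ^^ k) x) - covariance i l\<bar> \<le> c i l x * ?B ((T ^^ k) x)" for x
      proof -
        have "\<bar>c i l x * (?B ((T ^^ k) x) - covariance i l)\<bar> \<le> C * \<bar>?B ((T ^^ k) x) - covariance i l\<bar>"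
          unfolding abs_mult using C by (intro mult_right_mono) auto
        then show ?thesis by (simp only: right_diff_distrib abs_le_iff) linarith
      qed
      show "integrable M (\<lambda>x. c i l x * ?B ((T ^^ k) x))"
        by (rule integrable_bounded_mult[OF Bk _ C]) measurable
    qed (use Bk c_int in auto)
    moreover have "(\<integral>x. c i l x * covariance i l - C * \<bar>?B ((T ^^ k) x) - covariance i l\<bar> \<partial>M)
      = (\<integral>x. c i l x * covariance i l \<partial>M) - C * (\<integral>x. \<bar>?B ((T ^^ k) x) - covariance i l\<bar> \<partial>M)"
      using Bk c_int by (subst Bochner_Integration.integral_diff) auto
    \<comment> \<open>Invariance removes the shift by \<open>T ^^ k\<close>, so the error does not
      depend on the start of the block.\<close>
    moreover have "(\<integral>x. \<bar>?B ((T ^^ k) x) - covariance i l\<bar> \<partial>M) = ?E i l"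
      using f by (subst integral_iter[of "\<lambda>x. \<bar>?B x - covariance i l\<bar>"]) auto
    ultimately have "(\<integral>x. c i l x * covariance i l \<partial>M) - C * ?E i l \<le> (\<integral>x. c i l x * ?B ((T ^^ k) x) \<partial>M)"
      by simp
    then have "L * ((\<integral>x. c i l x * covariance i l \<partial>M) - C * ?E i l) \<le> L * (\<integral>x. c i l x * ?B ((T ^^ k) x) \<partial>M)"
      by (intro mult_left_mono) auto
    then show ?thesis unfolding eq by (simp add: algebra_simps)
  qed
  then have "(\<Sum>i\<in>UNIV. \<Sum>l\<in>UNIV. L * (\<integral>x. c i l x * covariance i l \<partial>M) - L * C * ?E i l)
    \<le> (\<Sum>i\<in>UNIV. \<Sum>l\<in>UNIV. (\<integral>x. c i l x * (?D x $ i * ?D x $ l) \<partial>M))"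
    by (intro sum_mono)
  moreover have "(\<Sum>i\<in>UNIV. \<Sum>l\<in>UNIV. L * (\<integral>x. c i l x * covariance i l \<partial>M) - L * C * ?E i l) =
    L * (\<integral>x. (\<Sum>i\<in>UNIV. \<Sum>l\<in>UNIV. c i l x * covariance i l) \<partial>M) - L * C * ergodic_error L"
    using c_int by (simp add: sum_subtractf sum_distrib_left ergodic_error_def f_def[abs_def])
  moreover have "(\<Sum>i\<in>UNIV. \<Sum>l\<in>UNIV. (\<integral>x. c i l x * (?D x $ i * ?D x $ l) \<partial>M)) =
    (\<integral>x. (\<Sum>i\<in>UNIV. \<Sum>l\<in>UNIV. c i l x * (?D x $ i * ?D x $ l)) \<partial>M)"
    using D_int by simp
  ultimately show ?thesis by simp
qed

end

text \<open>This is the pointwise subsolution inequality, with Q in the role of the variance in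
  direction v and V in that of the trace of the covariance. On the support |v|^2 = r^2 - W, so 12 W
  Q is at least 12 \<kappa> r^2 W - 12 \<kappa> W^2. Near the boundary of the ball the linear term
  wins over all terms in W^2; further inside, the multiple of W^3 compensates.\<close>

lemma bump_drift_ge:
  fixes v a :: "'b::real_inner" and V :: real
  assumes r: "0 < r" and \<kappa>: "0 < \<kappa>"
    and Q: "\<kappa> * (norm v)\<^sup>2 \<le> Q"
  defines "W \<equiv> bump_base r v" and "b \<equiv> 6 * norm a + 12 * \<kappa> + 3 * V"
  assumes r1: "r \<le> 1"
  shows "- (b\<^sup>2 / (48 * \<kappa> * r\<^sup>2)) * W^3 \<le> 6 * (W\<^sup>2 * (v \<bullet> a)) + (12 * W * Q - 3 * W\<^sup>2 * V)"
proof (cases "W = 0")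
  case False
  have W: "W > 0" using False bump_base_nonneg[of r v] unfolding W_def by simp
  have nv: "norm v \<le> 1" using bump_base_pos_norm[of r v] False r r1 unfolding W_def by auto
  have W_eq: "(norm v)\<^sup>2 = r\<^sup>2 - W" using False unfolding W_def bump_base_def by (auto simp: max_def split: if_splits)
  have "- (v \<bullet> a) \<le> norm a"
    using order_trans[OF Cauchy_Schwarz_ineq2[of v a] mult_right_mono[OF nv norm_ge_zero[of a]]] by simp
  then have 1: "W\<^sup>2 * (- (v \<bullet> a)) \<le> W\<^sup>2 * norm a" by (intro mult_left_mono) auto
  have 2: "W * (\<kappa> * (r\<^sup>2 - W)) \<le> W * Q" using Q W unfolding W_eq by (intro mult_left_mono) auto
  \<comment> \<open>Completing the square gives b W^2 \<le> b^2 / (48 \<kappa> r^2) W^3 + 12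
    \<kappa> r^2 W, where b collects all coefficients of W^2. This is where the decay rate comes
    from.\<close>
  have "0 \<le> W * ((b * W - 24 * \<kappa> * r\<^sup>2)\<^sup>2 / (48 * \<kappa> * r\<^sup>2))" using W \<kappa> by simp
  also have "(b * W - 24 * \<kappa> * r\<^sup>2)\<^sup>2 / (48 * \<kappa> * r\<^sup>2) = b\<^sup>2 / (48 * \<kappa> * r\<^sup>2) * W\<^sup>2 - b * W + 12 * \<kappa> * r\<^sup>2"
    using \<kappa> r by (simp add: field_simps power2_eq_square)
  also have "W * \<dots> = b\<^sup>2 / (48 * \<kappa> * r\<^sup>2) * W^3 - (6 * (W\<^sup>2 * norm a) + 12 * (\<kappa> * W\<^sup>2) + 3 * W\<^sup>2 * V) + 12 * (W * (\<kappa> * r\<^sup>2))"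
    unfolding b_def by (simp add: algebra_simps power2_eq_square power3_eq_cube)
  finally have 3: "0 \<le> b\<^sup>2 / (48 * \<kappa> * r\<^sup>2) * W^3 - (6 * (W\<^sup>2 * norm a) + 12 * (\<kappa> * W\<^sup>2) + 3 * W\<^sup>2 * V) + 12 * (W * (\<kappa> * r\<^sup>2))" .
  have 4: "W * (\<kappa> * (r\<^sup>2 - W)) = W * (\<kappa> * r\<^sup>2) - \<kappa> * W\<^sup>2" by (simp add: algebra_simps power2_eq_square)
  show ?thesis using 1 2 3 unfolding 4 by linarith
qed simp

section \<open>The expected barrier along a moving ball\<close>

context martingale_cocycle
begin

text \<open>The scaled position relative to the moving centre. With \<epsilon> = 1 / sqrt n the
  centre has arrived at a at time k = n.\<close>

definition walk :: "real \<Rightarrow> real ^ 'n \<Rightarrow> nat \<Rightarrow> 'a \<Rightarrow> real ^ 'n" where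
  "walk \<epsilon> a k x = \<epsilon> *\<^sub>R birkhoff_sum T \<Phi> k x - (\<epsilon>\<^sup>2 * k) *\<^sub>R a"

lemma walk_add: "walk \<epsilon> a (k + L) x = walk \<epsilon> a k x + (\<epsilon> *\<^sub>R partial_sum k L x - (\<epsilon>\<^sup>2 * L) *\<^sub>R a)"
  unfolding walk_def birkhoff_sum_add partial_sum_eq by (simp add: algebra_simps)

lemma walk_adapted: "walk \<epsilon> a k \<in> borel_measurable (H k)"
  using adapted_partial_sum[of 0 k] unfolding walk_def birkhoff_sum_eq_partial_sum by simp

text \<open>The mean of the error of \<open>bump_block\<close> without its factor \<epsilon>^2. The
  block may start at time 0 because the measure is invariant.\<close>

definition remainder :: "nat \<Rightarrow> real ^ 'n \<Rightarrow> real \<Rightarrow> real" where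
  "remainder L a \<epsilon> = (\<integral>x. (norm (partial_sum 0 L x) + L * norm a)\<^sup>2 *
     (30 * \<epsilon> + 39 * min 1 (\<epsilon> * (norm (partial_sum 0 L x) + L * norm a))) \<partial>M)"

lemma remainder_majorant_int: "integrable M (\<lambda>x. (norm (partial_sum k L x) + L * norm a)\<^sup>2)"
  using partial_sum_norm_sq[of k L] integrable_square_imp[OF _ partial_sum_norm_sq[of k L]]
  by (simp add: power2_sum mult.assoc)

text \<open>\<open>bump_block\<close> is integrated. The first-order term has mean 0, the
  second-order term is compared with the covariance by \<open>integral_quadratic_ge\<close>, and
  \<open>bump_drift_ge\<close> bounds the result below by a multiple of the expected barrier itself.
  Thus one block loses a factor 1 - rate \<epsilon>^2 L and a small additive error.\<close>

lemma bump_block_integral: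
  fixes a :: "real ^ 'n" and \<epsilon> r \<kappa> :: real
  assumes r: "0 < r" "r \<le> 1" and e: "0 < \<epsilon>" "\<epsilon> \<le> 1" and L: "L > 0" and \<kappa>: "\<kappa> > 0"
    "\<And>v. \<kappa> * (norm v)\<^sup>2 \<le> (\<Sum>i\<in>UNIV. \<Sum>l\<in>UNIV. v $ i * v $ l * covariance i l)"
  defines "rate \<equiv> (6 * norm a + 12 * \<kappa> + 3 * (\<Sum>i\<in>UNIV. covariance i i))\<^sup>2 / (48 * \<kappa> * r\<^sup>2)"
  shows "(1 - rate * \<epsilon>\<^sup>2 * L) * (\<integral>x. (bump_base r (walk \<epsilon> a k x))^3 \<partial>M)
    - \<epsilon>\<^sup>2 * (15 * L * ergodic_error L + remainder L a \<epsilon>)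
    \<le> (\<integral>x. (bump_base r (walk \<epsilon> a (k + L) x))^3 \<partial>M)"
proof -
  define Y where "Y = walk \<epsilon> a k"
  define W where "W x = bump_base r (Y x)" for x
  define D where "D = partial_sum k L"
  define Z where "Z x = norm (D x) + L * norm a" for x
  define R where "R x = (Z x)\<^sup>2 * (30 * \<epsilon> + 39 * min 1 (\<epsilon> * Z x))" for x
  define c where "c i l x = 12 * W x * Y x $ i * Y x $ l - (if i = l then 3 * (W x)\<^sup>2 else 0)" for i l x
  define V where "V = (\<Sum>i\<in>UNIV. covariance i i)"
  note YH [measurable] = walk_adapted[of \<epsilon> a k, folded Y_def]
  have WH [measurable]: "W \<in> borel_measurable (H k)"
    unfolding W_def bump_base_def by measurable
  have cH: "c i l \<in> borel_measurable (H k)" for i l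
    unfolding c_def by (cases "i = l") simp_all
  have [measurable]: "Y \<in> borel_measurable M" "W \<in> borel_measurable M" "\<And>i l. c i l \<in> borel_measurable M"
    "D \<in> borel_measurable M"
    using measurable_from_subalg[OF subalg YH] measurable_from_subalg[OF subalg WH]
      measurable_from_subalg[OF subalg cH] by (simp_all add: D_def)
  have W: "0 \<le> W x" "W x \<le> 1" "(W x)\<^sup>2 \<le> 1" "(W x)^3 \<le> 1" for x
  proof -
    show *: "0 \<le> W x" "W x \<le> 1"
      unfolding W_def using bump_base_nonneg bump_base_le[of r "Y x"] power_le_one[of r 2] r by (auto intro: order_trans)
    show "(W x)\<^sup>2 \<le> 1" "(W x)^3 \<le> 1" using * by (auto simp: power_le_one)
  qed
  have Yn: "norm (Y x) \<le> 1" if "W x \<noteq> 0" for x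
    using bump_base_pos_norm[of r "Y x"] that r unfolding W_def by auto
  have Yi: "\<bar>Y x $ i\<bar> \<le> 1" if "W x \<noteq> 0" for x i
    using component_le_norm_cart[of "Y x" i] Yn[OF that] by simp
  \<comment> \<open>The coefficients vanish where W = 0, and elsewhere |Y| \<le> 1; 15 is 12 for the
    product term plus 3 for the diagonal.\<close>
  have cC: "\<bar>c i l x\<bar> \<le> 15" for i l x
  proof (cases "W x = 0")
    case False
    have "\<bar>W x * (Y x $ i * Y x $ l)\<bar> \<le> 1 * (1 * 1)"
      unfolding abs_mult using W Yi[OF False] by (intro mult_mono) auto
    moreover have "c i l x = 12 * (W x * (Y x $ i * Y x $ l)) - (if i = l then 3 * (W x)\<^sup>2 else 0)"
      by (simp add: c_def mult.assoc)
    moreover have "0 \<le> (if i = l then 3 * (W x)\<^sup>2 else 0)" "(if i = l then 3 * (W x)\<^sup>2 else 0) \<le> 3"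
      using W(3)[of x] by auto
    ultimately show ?thesis by linarith
  qed (simp add: c_def)
  have W2Y: "\<bar>(W x)\<^sup>2 * Y x $ i\<bar> \<le> 1" for x i
  proof (cases "W x = 0")
    case False
    have "\<bar>(W x)\<^sup>2 * Y x $ i\<bar> \<le> 1 * 1"
      unfolding abs_mult using W Yi[OF False] by (intro mult_mono) auto
    then show ?thesis by simp
  qed simp
  have W3_int: "integrable M (\<lambda>x. (W x)^3)"
    using W by (intro integrable_const_bound[of _ 1]) auto
  have W2Y_int: "integrable M (\<lambda>x. (W x)\<^sup>2 * Y x $ i)" for i
    using W2Y by (intro integrable_const_bound[of _ 1]) auto
  have W2YD_int: "integrable M (\<lambda>x. (W x)\<^sup>2 * Y x $ i * D x $ i)" for i
    unfolding D_def by (rule integrable_bounded_mult[OF integrable_square_imp[OF _ partial_sum_nth_sq] _ W2Y]) measurable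
  have drift_eq: "(W x)\<^sup>2 * (Y x \<bullet> D x) = (\<Sum>i\<in>UNIV. (W x)\<^sup>2 * Y x $ i * D x $ i)" for x
    by (simp add: inner_vec_def sum_distrib_left mult.assoc)
  have "(\<integral>x. (W x)\<^sup>2 * Y x $ i * D x $ i \<partial>M) = 0" for i
    unfolding D_def by (rule integral_bounded_times_partial_sum[OF _ W2Y]) measurable
  then have drift: "integrable M (\<lambda>x. (W x)\<^sup>2 * (Y x \<bullet> D x))" "(\<integral>x. (W x)\<^sup>2 * (Y x \<bullet> D x) \<partial>M) = 0"
    unfolding drift_eq using W2YD_int by simp_all
  have Ya_int: "integrable M (\<lambda>x. (W x)\<^sup>2 * (Y x \<bullet> a))"
  proof -
    have "(W x)\<^sup>2 * (Y x \<bullet> a) = (\<Sum>i\<in>UNIV. (W x)\<^sup>2 * Y x $ i * a $ i)" for x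
      by (simp add: inner_vec_def sum_distrib_left mult.assoc)
    then show ?thesis using W2Y_int by simp
  qed
  let ?q = "\<lambda>x. \<Sum>i\<in>UNIV. \<Sum>l\<in>UNIV. c i l x * (D x $ i * D x $ l)"
  let ?s = "\<lambda>x. \<Sum>i\<in>UNIV. \<Sum>l\<in>UNIV. c i l x * covariance i l"
  have "integrable M (\<lambda>x. c i l x * (D x $ i * D x $ l))" for i l
    unfolding D_def by (rule integrable_bounded_mult[OF integrable_mult_L2 _ cC]; (rule partial_sum_nth_sq | measurable))
  then have q_int: "integrable M ?q" by simp
  have "integrable M (c i l)" for i l
    using cC by (intro integrable_const_bound[of _ 15]) auto
  then have s_int: "integrable M ?s" by simp
  have R_int: "integrable M R"
  proof -
    have "integrable M (\<lambda>x. (30 * \<epsilon> + 39 * min 1 (\<epsilon> * Z x)) * (Z x)\<^sup>2)"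
    proof (rule integrable_bounded_mult[where C=69])
      show "\<bar>30 * \<epsilon> + 39 * min 1 (\<epsilon> * Z x)\<bar> \<le> 69" for x
      proof -
        have "0 \<le> \<epsilon> * Z x" using e by (simp add: Z_def)
        then show ?thesis using e by (auto simp: min_def abs_le_iff)
      qed
      show "integrable M (\<lambda>x. (Z x)\<^sup>2)" unfolding Z_def D_def by (rule remainder_majorant_int)
      show "(\<lambda>x. 30 * \<epsilon> + 39 * min 1 (\<epsilon> * Z x)) \<in> borel_measurable M" unfolding Z_def by measurable
    qed
    then show ?thesis unfolding R_def by (simp add: mult.commute)
  qed
  have R_eq: "(\<integral>x. R x \<partial>M) = remainder L a \<epsilon>"
  proof -
    define g where "g x = (norm (partial_sum 0 L x) + L * norm a)\<^sup>2 *
     (30 * \<epsilon> + 39 * min 1 (\<epsilon> * (norm (partial_sum 0 L x) + L * norm a)))" for x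
    have "R x = g ((T ^^ k) x)" for x
      by (simp add: R_def Z_def D_def g_def partial_sum_eq)
    moreover have "g \<in> borel_measurable M" unfolding g_def by measurable
    ultimately show ?thesis using integral_iter[of g k] by (simp add: remainder_def g_def)
  qed
  let ?lower = "\<lambda>x. (W x)^3 - 6 * \<epsilon> * ((W x)\<^sup>2 * (Y x \<bullet> D x)) + 6 * \<epsilon>\<^sup>2 * L * ((W x)\<^sup>2 * (Y x \<bullet> a))
    + \<epsilon>\<^sup>2 * ?q x - \<epsilon>\<^sup>2 * R x"
  have lower_int: "(\<integral>x. ?lower x \<partial>M) = (\<integral>x. (W x)^3 \<partial>M) + 6 * \<epsilon>\<^sup>2 * L * (\<integral>x. (W x)\<^sup>2 * (Y x \<bullet> a) \<partial>M)
     + \<epsilon>\<^sup>2 * (\<integral>x. ?q x \<partial>M) - \<epsilon>\<^sup>2 * remainder L a \<epsilon>"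
  proof -
    have "(\<integral>x. A x - 6 * \<epsilon> * B x + 6 * \<epsilon>\<^sup>2 * L * C x + \<epsilon>\<^sup>2 * E x - \<epsilon>\<^sup>2 * G x \<partial>M) =
       (\<integral>x. A x \<partial>M) - 6 * \<epsilon> * (\<integral>x. B x \<partial>M) + 6 * \<epsilon>\<^sup>2 * L * (\<integral>x. C x \<partial>M) + \<epsilon>\<^sup>2 * (\<integral>x. E x \<partial>M) - \<epsilon>\<^sup>2 * (\<integral>x. G x \<partial>M)"
      if "integrable M A" "integrable M B" "integrable M C" "integrable M E" "integrable M G" for A B C E G :: "'a \<Rightarrow> real"
      using that by simp
    from this[OF W3_int drift(1) Ya_int q_int R_int] show ?thesis unfolding drift(2) R_eq by simp
  qed
  have "(\<integral>x. ?lower x \<partial>M) \<le> (\<integral>x. (bump_base r (walk \<epsilon> a (k + L) x))^3 \<partial>M)"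
  proof (rule integral_mono)
    show "integrable M ?lower" using W3_int drift(1) Ya_int q_int R_int by auto
    have b: "\<bar>bump_base r v\<bar> \<le> 1" for v :: "real ^ 'n"
      using bump_base_nonneg[of r v] bump_base_le[of r v] power_le_one[of r 2] r by auto
    have "walk \<epsilon> a (k + L) \<in> borel_measurable M" by (rule measurable_from_subalg[OF subalg walk_adapted])
    then have "(\<lambda>x. bump_base r (walk \<epsilon> a (k + L) x)) \<in> borel_measurable M" unfolding bump_base_def by simp
    then show "integrable M (\<lambda>x. (bump_base r (walk \<epsilon> a (k + L) x))^3)"
      using b by (intro integrable_const_bound[of _ 1]) (auto simp: power_abs power_le_one)
    show "?lower x \<le> (bump_base r (walk \<epsilon> a (k + L) x))^3" for x
      using bump_block[of r \<epsilon> "real L" "Y x" "D x" a] r e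
      unfolding walk_add c_def bump_quadratic_expand[symmetric] W_def Z_def R_def Y_def D_def by simp
  qed
  moreover have "L * (\<integral>x. ?s x \<partial>M) - real L * 15 * ergodic_error L \<le> (\<integral>x. ?q x \<partial>M)"
    unfolding D_def by (rule integral_quadratic_ge[OF cH cC L])
  then have "\<epsilon>\<^sup>2 * (L * (\<integral>x. ?s x \<partial>M) - real L * 15 * ergodic_error L) \<le> \<epsilon>\<^sup>2 * (\<integral>x. ?q x \<partial>M)"
    by (intro mult_left_mono) auto
  \<comment> \<open>Here \<open>bump_drift_ge\<close> is used with Q the covariance form at
    \<open>Y x\<close> and V the trace.\<close>
  moreover have "- rate * (\<integral>x. (W x)^3 \<partial>M) \<le> 6 * (\<integral>x. (W x)\<^sup>2 * (Y x \<bullet> a) \<partial>M) + (\<integral>x. ?s x \<partial>M)"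
  proof -
    have "(\<integral>x. - rate * (W x)^3 \<partial>M) \<le> (\<integral>x. 6 * ((W x)\<^sup>2 * (Y x \<bullet> a)) + ?s x \<partial>M)"
    proof (rule integral_mono)
      fix x
      have 1: "12 * W x * (\<Sum>i\<in>UNIV. \<Sum>l\<in>UNIV. Y x $ i * Y x $ l * covariance i l)
          = (\<Sum>i\<in>UNIV. \<Sum>l\<in>UNIV. 12 * W x * Y x $ i * Y x $ l * covariance i l)"
        by (simp add: sum_distrib_left mult_ac)
      have 2: "3 * (W x)\<^sup>2 * V
          = (\<Sum>i\<in>UNIV. \<Sum>l\<in>UNIV. (if i = l then 3 * (W x)\<^sup>2 else 0) * covariance i l)"
        by (simp add: V_def sum_distrib_left if_distrib[of "\<lambda>z. z * _"] sum.delta cong: if_cong)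
      have "?s x = 12 * W x * (\<Sum>i\<in>UNIV. \<Sum>l\<in>UNIV. Y x $ i * Y x $ l * covariance i l) - 3 * (W x)\<^sup>2 * V"
        unfolding 1 2 c_def by (simp add: left_diff_distrib sum_subtractf)
      then show "- rate * (W x)^3 \<le> 6 * ((W x)\<^sup>2 * (Y x \<bullet> a)) + ?s x"
        using bump_drift_ge[OF r(1) \<kappa>(1) \<kappa>(2) r(2), where v="Y x" and a=a and V=V]
        unfolding rate_def V_def W_def by simp
    qed (use W3_int Ya_int s_int in auto)
    then show ?thesis using W3_int Ya_int s_int by simp
  qed
  then have "\<epsilon>\<^sup>2 * L * (- rate * (\<integral>x. (W x)^3 \<partial>M)) \<le> \<epsilon>\<^sup>2 * L * (6 * (\<integral>x. (W x)\<^sup>2 * (Y x \<bullet> a) \<partial>M) + (\<integral>x. ?s x \<partial>M))"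
    by (intro mult_left_mono) auto
  ultimately show ?thesis
    unfolding lower_int W_def[symmetric] Y_def[symmetric] by (simp add: algebra_simps)
qed

end

section \<open>Scaled sums visit every ball\<close>

lemma affine_recursion_ge:
  fixes q :: "nat \<Rightarrow> real"
  assumes step: "\<And>j. (1 - s) * q j - e \<le> q (Suc j)" and s: "0 \<le> s" "s \<le> 1" and e: "0 \<le> e"
  shows "(1 - s) ^ m * q 0 - m * e \<le> q m"
proof (induction m)
  case (Suc m)
  have "(1 - s) * ((1 - s) ^ m * q 0 - m * e) \<le> (1 - s) * q m" using s by (intro mult_left_mono Suc) auto
  moreover have "(1 - s) * (m * e) \<le> 1 * (m * e)" using s e by (intro mult_right_mono) auto
  ultimately show ?case using step[of m] by (simp add: algebra_simps)
qed simp

context martingale_cocycle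
begin

text \<open>For a fixed block length the integrand tends to 0 pointwise and is dominated by (30 +
  39) Z^2, which is integrable because \<Phi> is square integrable.\<close>

lemma remainder_tendsto:
  assumes e: "\<And>n. 0 \<le> e n" "\<And>n. e n \<le> 1" and lim: "e \<longlonglongrightarrow> 0"
  shows "(\<lambda>n. remainder L a (e n)) \<longlonglongrightarrow> 0"
proof -
  define Z where "Z x = norm (partial_sum 0 L x) + L * norm a" for x
  have Z: "0 \<le> Z x" for x by (simp add: Z_def)
  have [measurable]: "Z \<in> borel_measurable M" unfolding Z_def by measurable
  have "(\<lambda>n. \<integral>x. (Z x)\<^sup>2 * (30 * e n + 39 * min 1 (e n * Z x)) \<partial>M) \<longlonglongrightarrow> (\<integral>x. 0 \<partial>M)"
  proof (rule integral_dominated_convergence[where w="\<lambda>x. 69 * (Z x)\<^sup>2"])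
    show "integrable M (\<lambda>x. 69 * (Z x)\<^sup>2)" using remainder_majorant_int[of 0 L a] by (simp add: Z_def)
    have "(\<lambda>n. (Z x)\<^sup>2 * (30 * e n + 39 * min 1 (e n * Z x))) \<longlonglongrightarrow> (Z x)\<^sup>2 * (30 * 0 + 39 * min 1 (0 * Z x))" for x
      by (intro tendsto_intros lim)
    then show "AE x in M. (\<lambda>n. (Z x)\<^sup>2 * (30 * e n + 39 * min 1 (e n * Z x))) \<longlonglongrightarrow> 0" by simp
    have "\<bar>30 * e n + 39 * min 1 (e n * Z x)\<bar> \<le> 69" for n x
    proof -
      have "0 \<le> e n * Z x" using e Z by simp
      then show ?thesis using e(1,2)[of n] by (auto simp: min_def abs_le_iff)
    qed
    then have "\<bar>(Z x)\<^sup>2 * (30 * e n + 39 * min 1 (e n * Z x))\<bar> \<le> (Z x)\<^sup>2 * 69" for n x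
      unfolding abs_mult by (intro mult_mono) auto
    then show "AE x in M. norm ((Z x)\<^sup>2 * (30 * e n + 39 * min 1 (e n * Z x))) \<le> 69 * (Z x)\<^sup>2" for n
      by (simp add: mult.commute)
  qed auto
  then show ?thesis by (simp add: remainder_def Z_def)
qed

text \<open>The time n is cut into m blocks of length L, with L fixed first so that the ergodic
  error is small, and m taken large afterwards. The block estimate is then iterated from the initial
  value r^6; the multiplicative losses combine to nearly exp (- rate).\<close>

lemma prob_scaled_sum_in_ball:
  fixes a :: "real ^ 'n"
  assumes r: "0 < r" "r \<le> 1"
  shows "\<exists>c>0. \<forall>n0. \<exists>n\<ge>n0. c \<le> prob {x \<in> space M. norm (birkhoff_sum T \<Phi> n x /\<^sub>R sqrt n - a) < r}"
proof -
  obtain \<kappa> where \<kappa>: "\<kappa> > 0" "\<And>v. \<kappa> * (norm v)\<^sup>2 \<le> (\<Sum>i\<in>UNIV. \<Sum>l\<in>UNIV. v $ i * v $ l * covariance i l)"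
    using covariance_pos_definite by blast
  define rate where "rate = (6 * norm a + 12 * \<kappa> + 3 * (\<Sum>i\<in>UNIV. covariance i i))\<^sup>2 / (48 * \<kappa> * r\<^sup>2)"
  have rate: "rate \<ge> 0" using \<kappa> by (simp add: rate_def)
  \<comment> \<open>Up to half of the limiting factor may be lost, which leaves 4c; the additive
    errors take at most 2c. This c is chosen before L and does not depend on it.\<close>
  define c where "c = exp (- rate) * r^6 / 8"
  have c: "c > 0" using r by (simp add: c_def)
  have "\<forall>\<^sub>F L in sequentially. 15 * ergodic_error L < c \<and> L > 0"
    using order_tendstoD(2)[OF ergodic_error_tendsto, of "c / 15"] c
    by (intro eventually_conj eventually_gt_at_top) (simp add: mult.commute)
  then obtain L where L: "15 * ergodic_error L < c" "L > 0" by (auto dest: eventually_happens)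
  have err_nn: "ergodic_error L \<ge> 0" unfolding ergodic_error_def by (intro sum_nonneg) simp
  have "\<exists>n\<ge>n0. c \<le> prob {x \<in> space M. norm (birkhoff_sum T \<Phi> n x /\<^sub>R sqrt n - a) < r}" for n0
  proof -
    define e where "e m = 1 / sqrt (Suc m * L)" for m
    have e: "0 < e m" "e m \<le> 1" for m
    proof -
      have "1 \<le> Suc m * L" using L by simp
      then have "real 1 \<le> real (Suc m * L)" by (rule of_nat_mono)
      then have "1 \<le> real (Suc m * L)" by (simp only: of_nat_1)
      then show "0 < e m" "e m \<le> 1" unfolding e_def by (simp_all del: mult_Suc of_nat_mult)
    qed
    have "filterlim (\<lambda>m. Suc m * L) at_top sequentially"
    proof (rule filterlim_at_top_mono[OF filterlim_Suc])
      have "Suc m * 1 \<le> Suc m * L" for m by (rule mult_le_mono2) (use L in simp)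
      then show "\<forall>\<^sub>F m in sequentially. Suc m \<le> Suc m * L" by (simp only: mult_1_right eventually_True)
    qed
    then have "filterlim (\<lambda>m. sqrt (Suc m * L)) at_top sequentially"
      by (intro filterlim_compose[OF sqrt_at_top] filterlim_compose[OF filterlim_real_sequentially])
    then have "e \<longlonglongrightarrow> 0"
      unfolding e_def[abs_def] by (intro tendsto_divide_0[OF tendsto_const] filterlim_at_top_imp_at_infinity)
    then have "(\<lambda>m. remainder L a (e m)) \<longlonglongrightarrow> 0"
      using e by (intro remainder_tendsto) (auto intro: less_imp_le)
    then have 1: "\<forall>\<^sub>F m in sequentially. remainder L a (e m) < c * L"
      using c L by (intro order_tendstoD) auto
    have "(\<lambda>n. (1 + (- rate) / real n) ^ n) \<longlonglongrightarrow> exp (- rate)"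
      by (rule tendsto_exp_limit_sequentially)
    then have "(\<lambda>n. (1 + (- rate) / real (Suc n)) ^ Suc n) \<longlonglongrightarrow> exp (- rate)"
      by (rule LIMSEQ_Suc)
    then have 2: "\<forall>\<^sub>F m in sequentially. exp (- rate) / 2 < (1 + (- rate) / real (Suc m)) ^ Suc m"
      by (rule order_tendstoD) simp
    \<comment> \<open>This keeps the factor 1 - rate / m of the recursion nonnegative.\<close>
    have 3: "\<forall>\<^sub>F m in sequentially. rate \<le> real m"
      using filterlim_real_sequentially by (simp add: filterlim_at_top)
    have "\<forall>\<^sub>F m in sequentially. remainder L a (e m) < c * L \<and>
        exp (- rate) / 2 < (1 + (- rate) / real (Suc m)) ^ Suc m \<and> rate \<le> real m \<and> n0 \<le> m"
      using 1 2 3 eventually_ge_at_top[of n0] by eventually_elim simp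
    then obtain m' where m': "remainder L a (e m') < c * L"
        "exp (- rate) / 2 < (1 + (- rate) / real (Suc m')) ^ Suc m'" "rate \<le> real m'" "n0 \<le> m'"
      by (auto dest: eventually_happens)
    define m where "m = Suc m'"
    define n where "n = m * L"
    define \<epsilon> where "\<epsilon> = e m'"
    have "m \<le> n" unfolding n_def using mult_le_mono2[of 1 L m] L by simp
    then have n: "n \<ge> n0" "n > 0" using m'(4) by (auto simp: m_def)
    have \<epsilon>: "0 < \<epsilon>" "\<epsilon> \<le> 1" "\<epsilon> = 1 / sqrt n" using e[of m'] by (auto simp: \<epsilon>_def e_def n_def m_def)
    have \<epsilon>2: "\<epsilon>\<^sup>2 = 1 / n" using n by (simp add: \<epsilon> power_divide)
    have \<epsilon>2L: "\<epsilon>\<^sup>2 * L = 1 / m" using L by (simp add: \<epsilon>2 n_def)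
    have rem_nn: "remainder L a \<epsilon> \<ge> 0"
      unfolding remainder_def using \<epsilon>
      by (intro Bochner_Integration.integral_nonneg mult_nonneg_nonneg add_nonneg_nonneg) auto
    define q where "q j = (\<integral>x. (bump_base r (walk \<epsilon> a (j * L) x))^3 \<partial>M)" for j
    define err where "err = \<epsilon>\<^sup>2 * (15 * L * ergodic_error L + remainder L a \<epsilon>)"
    have "(1 - rate / m) ^ m * q 0 - m * err \<le> q m"
    proof (rule affine_recursion_ge)
      show "(1 - rate / m) * q j - err \<le> q (Suc j)" for j
      proof -
        have "rate * \<epsilon>\<^sup>2 * L = rate / m" using \<epsilon>2L by (simp add: mult.assoc)
        then show ?thesis
          using bump_block_integral[OF r \<epsilon>(1,2) L(2) \<kappa>, of a "j * L"]
          unfolding rate_def[symmetric] q_def err_def by (simp add: add.commute)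
      qed
      show "0 \<le> rate / m" using rate by simp
      show "rate / m \<le> 1" using m' by (simp add: m_def)
      show "0 \<le> err" unfolding err_def using err_nn rem_nn by simp
    qed
    moreover have "q 0 = r^6"
      by (simp add: q_def walk_def bump_base_def prob_space flip: power_mult)
    moreover have "exp (- rate) / 2 * r^6 \<le> (1 - rate / m) ^ m * r^6"
      using m' r by (intro mult_right_mono) (auto simp: m_def)
    \<comment> \<open>Over all m blocks the ergodic error and the Taylor remainder contribute at
      most c each.\<close>
    moreover have "m * err \<le> 2 * c"
    proof -
      have "m > 0" by (simp add: m_def)
      then have "m * \<epsilon>\<^sup>2 = 1 / L" using L by (simp add: \<epsilon>2 n_def)
      then have "m * err = (15 * L * ergodic_error L + remainder L a \<epsilon>) / L"
        unfolding err_def mult.assoc[symmetric, of "real m"] by simp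
      also have "\<dots> = 15 * ergodic_error L + remainder L a \<epsilon> / L" using L by (simp add: field_simps)
      also have "remainder L a \<epsilon> / L \<le> c" using m'(1) L by (simp add: \<epsilon>_def field_simps)
      finally show ?thesis using L by simp
    qed
    ultimately have "c \<le> q m" using c by (simp add: c_def)
    \<comment> \<open>The cubed bump is at most 1 and vanishes outside the ball.\<close>
    also have "q m \<le> (\<integral>x. indicator {x \<in> space M. norm (birkhoff_sum T \<Phi> n x /\<^sub>R sqrt n - a) < r} x \<partial>M)"
      unfolding q_def
    proof (rule integral_mono')
      fix x assume x: "x \<in> space M"
      have walk: "walk \<epsilon> a (m * L) x = birkhoff_sum T \<Phi> n x /\<^sub>R sqrt n - a"
        unfolding walk_def \<epsilon>2 n_def[symmetric] using n by (simp add: \<epsilon>(3) divide_inverse)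
      show "(bump_base r (walk \<epsilon> a (m * L) x))^3 \<le>
          indicator {x \<in> space M. norm (birkhoff_sum T \<Phi> n x /\<^sub>R sqrt n - a) < r} x"
      proof (cases "bump_base r (walk \<epsilon> a (m * L) x) = 0")
        case False
        have "bump_base r (walk \<epsilon> a (m * L) x) \<le> 1"
          using bump_base_le[of r "walk \<epsilon> a (m * L) x"] power_le_one[of r 2] r by auto
        then have "(bump_base r (walk \<epsilon> a (m * L) x))^3 \<le> 1" by (intro power_le_one bump_base_nonneg)
        then show ?thesis using bump_base_pos_norm[OF _ False] r x unfolding walk by simp
      qed simp
    next
      show "integrable M (indicator {x \<in> space M. norm (birkhoff_sum T \<Phi> n x /\<^sub>R sqrt n - a) < r} :: 'a \<Rightarrow> real)"
        by (intro integrable_real_indicator) (auto simp: emeasure_eq_measure)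
    qed auto
    also have "\<dots> = prob {x \<in> space M. norm (birkhoff_sum T \<Phi> n x /\<^sub>R sqrt n - a) < r}"
      by simp
    finally show ?thesis using n by blast
  qed
  with c show ?thesis by blast
qed

text \<open>A visit to \<open>E\<close> within \<open>m\<close> steps is likely, and \<open>m\<close> steps do not change \<open>\<Phi>\<^sub>n\<close> by an amount of order
  \<open>\<surd>n\<close>. So time \<open>0\<close> and time \<open>n\<close> can be replaced with nearby visits to \<open>E\<close>.\<close>

lemma visit_with_sum_in_cone:
  assumes E: "E \<in> sets M" "prob E > 0" and r: "r > 0"
    and K: "\<And>s v. s0 \<le> s \<Longrightarrow> norm (v - u) < 2 * r \<Longrightarrow> s *\<^sub>R v \<in> K"
  obtains x n where "x \<in> E" "1 \<le> n" "(T ^^ n) x \<in> E" "birkhoff_sum T \<Phi> n x \<in> K"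
proof -
  define \<rho> where "\<rho> = min r 1"
  have \<rho>: "0 < \<rho>" "\<rho> \<le> 1" "\<rho> \<le> r" using r by (auto simp: \<rho>_def)
  obtain c where c: "c > 0"
    "\<And>n0. \<exists>n\<ge>n0. c \<le> prob {x \<in> space M. norm (birkhoff_sum T \<Phi> n x /\<^sub>R sqrt n - u) < \<rho>}"
    using prob_scaled_sum_in_ball[OF \<rho>(1,2), of u] by blast
  note [measurable] = E(1)
  obtain m where m: "prob {x \<in> space M. \<forall>i<m. (T ^^ i) x \<notin> E} < c / 4"
    using prob_no_visit_small[OF E, of "c / 4"] c by auto
  \<comment> \<open>\<open>G\<close> bounds the change of the sum over any number of steps below m,
    at whatever point it is evaluated.\<close>
  define G where "G = birkhoff_sum T (\<lambda>x. norm (\<Phi> x)) m"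
  have [measurable]: "G \<in> borel_measurable M" unfolding G_def by measurable
  have "(\<lambda>R. prob {x \<in> space M. real R < G x}) \<longlonglongrightarrow> prob (\<Inter>R. {x \<in> space M. real R < G x})"
    by (rule finite_Lim_measure_decseq) (auto simp: decseq_def)
  moreover have "(\<Inter>R. {x \<in> space M. real R < G x}) = {}"
    using reals_Archimedean2 by (auto, meson not_less_iff_gr_or_eq)
  ultimately have "\<forall>\<^sub>F R in sequentially. prob {x \<in> space M. real R < G x} < c / 4"
    using c by (intro order_tendstoD) auto
  then obtain R :: nat where R: "prob {x \<in> space M. real R < G x} < c / 4" by (auto dest: eventually_happens)
  have "filterlim (\<lambda>n. sqrt (real n)) at_top sequentially"
    by (rule filterlim_compose[OF sqrt_at_top filterlim_real_sequentially])
  then have "\<forall>\<^sub>F n in sequentially. max 1 (max s0 (2 * R / r + 1)) \<le> sqrt (real n)"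
    by (simp only: filterlim_at_top)
  then obtain n0 where n0: "\<And>n. n \<ge> n0 \<Longrightarrow> max 1 (max s0 (2 * R / r + 1)) \<le> sqrt (real n)"
    by (auto simp: eventually_sequentially)
  obtain n where n: "n \<ge> max m n0" "c \<le> prob {x \<in> space M. norm (birkhoff_sum T \<Phi> n x /\<^sub>R sqrt n - u) < \<rho>}"
    using c(2) by blast
  have sn: "1 \<le> sqrt n" "s0 \<le> sqrt n" "2 * R / r < sqrt n" using n0[of n] n by auto
  let ?good = "{x \<in> space M. norm (birkhoff_sum T \<Phi> n x /\<^sub>R sqrt n - u) < \<rho>}"
  let ?A = "{x \<in> space M. \<forall>i<m. (T ^^ i) x \<notin> E}" and ?B = "{x \<in> space M. real R < G x}"
  let ?A' = "{x \<in> space M. (T ^^ n) x \<in> ?A}" and ?B' = "{x \<in> space M. (T ^^ n) x \<in> ?B}"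
  \<comment> \<open>The four bad events, a late visit or a large \<open>G\<close> at time 0 or at
    time n, have measure below c/4 each, so they cannot cover a set of measure at least c.\<close>
  have "\<not> ?good \<subseteq> (?A \<union> ?B) \<union> (?A' \<union> ?B')"
  proof
    assume "?good \<subseteq> (?A \<union> ?B) \<union> (?A' \<union> ?B')"
    then have "prob ?good \<le> prob ((?A \<union> ?B) \<union> (?A' \<union> ?B'))"
      by (intro finite_measure_mono) measurable
    also have "\<dots> \<le> prob (?A \<union> ?B) + prob (?A' \<union> ?B')"
      by (intro measure_Un_le) measurable
    also have "\<dots> \<le> (prob ?A + prob ?B) + (prob ?A' + prob ?B')"
      by (intro add_mono measure_Un_le) measurable
    also have "prob ?A' = prob ?A" by (rule prob_iter) measurable
    also have "prob ?B' = prob ?B" by (rule prob_iter) measurable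
    finally show False using m R n(2) by simp
  qed
  then obtain x where x: "x \<in> ?good" "x \<notin> ?A" "x \<notin> ?B" "x \<notin> ?A'" "x \<notin> ?B'" by blast
  have xs: "x \<in> space M" "(T ^^ n) x \<in> space M" using x(1) iter_space by auto
  obtain i where i: "i < m" "(T ^^ i) x \<in> E" using x(2) xs by auto
  obtain j where j: "j < m" "(T ^^ j) ((T ^^ n) x) \<in> E" using x(4) xs by auto
  have G: "G x \<le> R" "G ((T ^^ n) x) \<le> R" using x(3,5) xs by auto
  have small: "norm (birkhoff_sum T \<Phi> k y) \<le> G y" if "k < m" for k y
  proof -
    have "norm (birkhoff_sum T \<Phi> k y) \<le> (\<Sum>l<k. norm (\<Phi> ((T ^^ l) y)))"
      unfolding birkhoff_sum_def by (rule norm_sum)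
    also have "\<dots> \<le> (\<Sum>l<m. norm (\<Phi> ((T ^^ l) y)))" using that by (intro sum_mono2) auto
    finally show ?thesis by (simp add: G_def birkhoff_sum_def)
  qed
  \<comment> \<open>The visit at time i is the new starting point and the one at time n + j the
    return. Since n \<ge> m > i, this return takes at least one step.\<close>
  define N where "N = n + j - i"
  have iN: "i + N = n + j" using n i unfolding N_def by simp
  have "(T ^^ N) ((T ^^ i) x) = (T ^^ (i + N)) x" by (simp add: funpow_add add.commute[of i] del: funpow.simps)
  also have "\<dots> = (T ^^ j) ((T ^^ n) x)" unfolding iN by (simp add: funpow_add add.commute[of n])
  finally have TN: "(T ^^ N) ((T ^^ i) x) \<in> E" using j by simp
  define d where "d = birkhoff_sum T \<Phi> j ((T ^^ n) x) - birkhoff_sum T \<Phi> i x"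
  have S: "birkhoff_sum T \<Phi> N ((T ^^ i) x) = birkhoff_sum T \<Phi> n x + d"
    using birkhoff_sum_add[of T \<Phi> i N x] birkhoff_sum_add[of T \<Phi> n j x] unfolding iN d_def
    by (simp add: algebra_simps)
  have "norm d \<le> 2 * R"
    using norm_triangle_ineq4[of "birkhoff_sum T \<Phi> j ((T ^^ n) x)" "birkhoff_sum T \<Phi> i x"]
      small[OF j(1), of "(T ^^ n) x"] small[OF i(1), of x] G unfolding d_def by linarith
  then have "norm (d /\<^sub>R sqrt n) \<le> 2 * R / sqrt n" using sn by (simp add: divide_simps)
  also have "\<dots> < r" using sn r by (simp add: field_simps)
  finally have "norm (d /\<^sub>R sqrt n) < r" .
  moreover have "norm (birkhoff_sum T \<Phi> n x /\<^sub>R sqrt n - u) < r" using x(1) \<rho> by simp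
  \<comment> \<open>The radius 2r of the cone hypothesis leaves r for the original sum and r for the
    correction d at both ends.\<close>
  ultimately have "norm ((birkhoff_sum T \<Phi> n x /\<^sub>R sqrt n - u) + d /\<^sub>R sqrt n) < 2 * r"
    by (intro norm_triangle_lt) simp
  then have "norm (birkhoff_sum T \<Phi> N ((T ^^ i) x) /\<^sub>R sqrt n - u) < 2 * r"
    unfolding S by (simp add: algebra_simps)
  from K[OF sn(2) this] have "birkhoff_sum T \<Phi> N ((T ^^ i) x) \<in> K" using sn by simp
  moreover have "1 \<le> N" using n(1) i(1) unfolding N_def by linarith
  ultimately show ?thesis using that i(2) TN by blast
qed

end

section \<open>Limit directions of induced cocycles\<close>

text \<open>Every time at which the orbit is in B is a sum of consecutive return times. Strong
  induction goes back to the last earlier visit p, from which the return time is exactly n -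
  p.\<close>

lemma induced_birkhoff_sum:
  assumes "x \<in> B" "(T ^^ n) x \<in> B"
  shows "\<exists>k. (induced_map T B ^^ k) x = (T ^^ n) x \<and>
    birkhoff_sum (induced_map T B) (induced_function T B f) k x = birkhoff_sum T f n x"
  using assms(2)
proof (induction n rule: less_induct)
  case (less n)
  show ?case
  proof (cases "n = 0")
    case True
    then show ?thesis by (intro exI[of _ 0]) simp
  next
    case False
    define p where "p = Max {i. i < n \<and> (T ^^ i) x \<in> B}"
    have fin: "finite {i. i < n \<and> (T ^^ i) x \<in> B}" by simp
    have "0 \<in> {i. i < n \<and> (T ^^ i) x \<in> B}" using False assms(1) by simp
    then have "p \<in> {i. i < n \<and> (T ^^ i) x \<in> B}" unfolding p_def by (intro Max_in[OF fin]) blast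
    then have p: "p < n" "(T ^^ p) x \<in> B" by auto
    have last: "(T ^^ i) x \<notin> B" if "p < i" "i < n" for i
    proof
      assume "(T ^^ i) x \<in> B"
      then have "i \<le> p" unfolding p_def using that by (intro Max_ge[OF fin]) simp
      with that show False by simp
    qed
    obtain k where k: "(induced_map T B ^^ k) x = (T ^^ p) x"
      "birkhoff_sum (induced_map T B) (induced_function T B f) k x = birkhoff_sum T f p x"
      using less.IH[OF p] by blast
    let ?y = "(T ^^ p) x"
    have iter: "(T ^^ j) ?y = (T ^^ (p + j)) x" for j by (simp add: funpow_add add.commute[of p])
    have ret: "return_time T B ?y = n - p"
      unfolding return_time_def
    proof (rule cInf_eq_minimum)
      show "n - p \<in> {j. 1 \<le> j \<and> (T ^^ j) ?y \<in> B}" using p less.prems by (simp add: iter)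
      show "n - p \<le> j" if "j \<in> {j. 1 \<le> j \<and> (T ^^ j) ?y \<in> B}" for j
        using that last[of "p + j"] unfolding iter by (cases "p + j < n") auto
    qed
    have "(induced_map T B ^^ Suc k) x = (T ^^ n) x"
      using k(1) p by (simp add: induced_map_def ret iter)
    moreover have "birkhoff_sum (induced_map T B) (induced_function T B f) (k + 1) x = birkhoff_sum T f (p + (n - p)) x"
      unfolding birkhoff_sum_add k
      by (simp add: birkhoff_sum_Suc induced_function_def ret)
    ultimately show ?thesis using p by (intro exI[of _ "Suc k"]) simp
  qed
qed

text \<open>The hypothesis does not ask for large indices, but these come for free: finitely many
  terms have bounded norm, so a sufficiently large lower bound on the norm excludes them. Indices
  can then be chosen increasingly.\<close>

lemma limit_direction_of_seqI:
  assumes "\<And>q::nat. \<exists>k. N (s k) > real q \<and> dist (s k /\<^sub>R N (s k)) u < 1 / Suc q"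
  shows "limit_direction_of_seq N s u"
proof -
  let ?P = "\<lambda>q k. N (s k) > real q \<and> dist (s k /\<^sub>R N (s k)) u < 1 / Suc q"
  have unbounded: "\<exists>k>K. ?P q k" for q K
  proof -
    obtain b :: nat where b: "Max ((\<lambda>i. N (s i)) ` {..K}) \<le> b" using real_arch_simple by blast
    \<comment> \<open>Raising q to at least b excludes the indices up to K and only sharpens both
      conditions.\<close>
    obtain k where k: "?P (max q b) k" using assms by blast
    have "k > K"
    proof (rule ccontr)
      assume "\<not> K < k"
      then have "N (s k) \<le> Max ((\<lambda>i. N (s i)) ` {..K})" by (intro Max_ge) auto
      moreover have "real b \<le> real (max q b)" by simp
      ultimately show False using b k by linarith
    qed
    moreover have "1 / real (Suc (max q b)) \<le> 1 / real (Suc q)" by (intro divide_left_mono) auto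
    with k have "?P q k" by (auto simp: less_le_trans)
    ultimately show ?thesis by blast
  qed
  have "\<exists>r. \<forall>q. ?P q (r q) \<and> r q < r (Suc q)"
    by (rule dependent_nat_choice) (use assms unbounded in blast)+
  then obtain r where r: "\<And>q. ?P q (r q)" "\<And>q. r q < r (Suc q)" by blast
  have "filterlim (\<lambda>k. N (s (r k))) at_top sequentially"
    by (rule filterlim_at_top_mono[OF filterlim_real_sequentially]) (use r(1) in \<open>auto intro!: always_eventually less_imp_le\<close>)
  moreover have "(\<lambda>k. s (r k) /\<^sub>R N (s (r k))) \<longlonglongrightarrow> u"
  proof (rule metric_LIMSEQ_I)
    fix e :: real assume "e > 0"
    then obtain m where m: "1 / Suc m < e" using nat_approx_posE by (metis of_nat_Suc)
    have "dist (s (r k) /\<^sub>R N (s (r k))) u < e" if "k \<ge> m" for k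
    proof -
      have "1 / real (Suc k) \<le> 1 / real (Suc m)" using that by (intro divide_left_mono) auto
      with r(1)[of k] m show ?thesis by linarith
    qed
    then show "\<exists>m. \<forall>k\<ge>m. dist (s (r k) /\<^sub>R N (s (r k))) u < e" by blast
  qed
  ultimately show ?thesis
    unfolding limit_direction_of_seq_def using r(2) by (intro exI[of _ r]) (simp add: strict_mono_Suc_iff)
qed

lemma AE_induced_measure:
  assumes B: "B \<in> sets M" and AE: "AE x in M. x \<in> B \<longrightarrow> P x"
  shows "AE x in induced_measure M B. P x"
proof -
  have "AE x in restrict_space M B. P x"
    using AE B sets.sets_into_space[OF B] by (subst AE_restrict_space_iff) (auto simp: Int_absorb2 intro: AE_mp)
  then obtain A where A: "{x \<in> space (restrict_space M B). \<not> P x} \<subseteq> A"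
    "emeasure (restrict_space M B) A = 0" "A \<in> sets (restrict_space M B)"
    by (rule AE_E)
  show ?thesis
    by (rule AE_I[of _ _ A]) (use A in \<open>auto simp: induced_measure_def space_scale_measure\<close>)
qed

section \<open>Cones around a direction for an arbitrary norm\<close>

lemma is_norm_continuous:
  fixes N :: "'b::euclidean_space \<Rightarrow> real"
  assumes "is_norm N" shows "continuous_on UNIV N"
proof (rule convex_on_continuous)
  show "convex_on UNIV N"
  proof (rule convex_onI)
    fix t x y assume "0 < t" "t < (1::real)"
    moreover have "N ((1 - t) *\<^sub>R x + t *\<^sub>R y) \<le> N ((1 - t) *\<^sub>R x) + N (t *\<^sub>R y)"
      using assms unfolding is_norm_def by blast
    moreover have "N (c *\<^sub>R z) = \<bar>c\<bar> * N z" for c z using assms unfolding is_norm_def by blast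
    ultimately show "N ((1 - t) *\<^sub>R x + t *\<^sub>R y) \<le> (1 - t) * N x + t * N y" by simp
  qed simp
qed simp

text \<open>Normalizing by N is continuous at u and unaffected by positive scaling, so a Euclidean
  ball around u fixes the direction for all s at once. On that ball N exceeds 1/2, hence s \<ge>
  2|q| + 1 makes the norm exceed q.\<close>

lemma is_norm_cone:
  fixes N :: "'b::euclidean_space \<Rightarrow> real"
  assumes N: "is_norm N" and u: "N u = 1" and e: "e > 0"
  shows "\<exists>r>0. \<exists>s0. \<forall>s\<ge>s0. \<forall>v. norm (v - u) < 2 * r \<longrightarrow>
    q < N (s *\<^sub>R v) \<and> dist ((s *\<^sub>R v) /\<^sub>R N (s *\<^sub>R v)) u < e"
proof -
  have scale: "N (c *\<^sub>R v) = \<bar>c\<bar> * N v" for c v using N by (simp add: is_norm_def)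
  have "isCont N u" using is_norm_continuous[OF N] by (simp add: continuous_on_eq_continuous_at)
  then have lim: "(N \<longlongrightarrow> N u) (nhds u)" by (simp add: isCont_def tendsto_nhds_iff)
  have "\<forall>\<^sub>F v in nhds u. 1 / 2 < N v" using lim by (rule order_tendstoD) (simp add: u)
  moreover have "((\<lambda>v. v /\<^sub>R N v) \<longlongrightarrow> u /\<^sub>R N u) (nhds u)"
    using lim u by (intro tendsto_intros filterlim_ident) auto
  then have "\<forall>\<^sub>F v in nhds u. dist (v /\<^sub>R N v) u < e" using e by (simp add: u tendsto_iff)
  ultimately have "\<forall>\<^sub>F v in nhds u. 1 / 2 < N v \<and> dist (v /\<^sub>R N v) u < e" by (rule eventually_conj)
  then obtain d where d: "d > 0" "\<And>v. dist v u < d \<Longrightarrow> 1 / 2 < N v \<and> dist (v /\<^sub>R N v) u < e"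
    unfolding eventually_nhds_metric by blast
  have "q < N (s *\<^sub>R v) \<and> dist ((s *\<^sub>R v) /\<^sub>R N (s *\<^sub>R v)) u < e"
    if s: "s \<ge> 2 * \<bar>q\<bar> + 1" and v: "norm (v - u) < 2 * (d / 2)" for s v
  proof
    have v': "1 / 2 < N v" "dist (v /\<^sub>R N v) u < e" using d(2)[of v] v by (auto simp: dist_norm)
    have "s * (1 / 2) \<le> s * N v" using v' s by (intro mult_left_mono) auto
    then show "q < N (s *\<^sub>R v)" using s unfolding scale by linarith
    have "N (s *\<^sub>R v) = s * N v" using s by (simp add: scale)
    moreover have "s > 0" using s by linarith
    ultimately have eq: "(s *\<^sub>R v) /\<^sub>R N (s *\<^sub>R v) = v /\<^sub>R N v" by (simp add: field_simps)
    show "dist ((s *\<^sub>R v) /\<^sub>R N (s *\<^sub>R v)) u < e" unfolding eq by (rule v'(2))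
  qed
  then show ?thesis using d(1) by (intro exI[of _ "d / 2"] conjI exI[of _ "2 * \<bar>q\<bar> + 1"]) auto
qed

section \<open>Returns with sums in every cone around a direction\<close>

context martingale_cocycle
begin

text \<open>The set of points of \<open>B\<close> whose returns to \<open>B\<close> all miss \<open>K\<close> has no return at a time \<open>n\<close> with
  \<open>\<Phi>\<^sub>n \<in> K\<close>, so it is null by the previous lemma.\<close>

lemma AE_visit_with_sum_in_cone:
  assumes B [measurable]: "B \<in> sets M" and K [measurable]: "K \<in> sets borel" and r: "r > 0"
    and cone: "\<And>s v. s0 \<le> s \<Longrightarrow> norm (v - u) < 2 * r \<Longrightarrow> s *\<^sub>R v \<in> K"
  shows "AE x in M. x \<in> B \<longrightarrow> (\<exists>n\<ge>1. (T ^^ n) x \<in> B \<and> birkhoff_sum T \<Phi> n x \<in> K)"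
proof -
  let ?E = "{x \<in> space M. x \<in> B \<and> (\<forall>n\<ge>1. \<not> ((T ^^ n) x \<in> B \<and> birkhoff_sum T \<Phi> n x \<in> K))}"
  have E: "?E \<in> sets M" by measurable
  have "prob ?E = 0"
  proof (rule ccontr)
    assume "prob ?E \<noteq> 0"
    then have "prob ?E > 0" by (simp add: zero_less_measure_iff)
    then obtain x n where "x \<in> ?E" "1 \<le> n" "(T ^^ n) x \<in> ?E" "birkhoff_sum T \<Phi> n x \<in> K"
      by (rule visit_with_sum_in_cone[OF E _ r cone])
    then show False by blast
  qed
  then have "AE x in M. x \<notin> ?E" using E by (simp add: prob_eq_0)
  then show ?thesis using AE_space by eventually_elim blast
qed

text \<open>Countably many sets \<open>K q\<close> encode that the norm is large and the direction
  close to u. Almost every point of B has for each q a return with sum in \<open>K q\<close>, and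
  such a sum is a term of the induced cocycle.\<close>

lemma limit_direction_induced:
  assumes N: "is_norm N" and u: "N u = 1" and B [measurable]: "B \<in> sets M"
  shows "limit_direction N (induced_measure M B) (induced_map T B) (induced_function T B \<Phi>) u"
proof -
  define K where "K q = {v. real q < N v \<and> dist (v /\<^sub>R N v) u < 1 / Suc q}" for q :: nat
  have [measurable]: "N \<in> borel_measurable borel"
    by (rule borel_measurable_continuous_onI[OF is_norm_continuous[OF N]])
  have "K q = {v \<in> space borel. real q < N v \<and> dist (v /\<^sub>R N v) u < 1 / Suc q}" for q by (simp add: K_def)
  then have K [measurable]: "K q \<in> sets borel" for q by simp
  have "AE x in M. x \<in> B \<longrightarrow> (\<exists>n\<ge>1. (T ^^ n) x \<in> B \<and> birkhoff_sum T \<Phi> n x \<in> K q)" for q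
  proof -
    obtain r s0 where "r > 0" "\<forall>s\<ge>s0. \<forall>v. norm (v - u) < 2 * r \<longrightarrow>
      real q < N (s *\<^sub>R v) \<and> dist ((s *\<^sub>R v) /\<^sub>R N (s *\<^sub>R v)) u < 1 / Suc q"
      using is_norm_cone[OF N u, of "1 / Suc q" "real q"] by auto
    then show ?thesis by (intro AE_visit_with_sum_in_cone[OF B K, of r s0 u]) (auto simp: K_def)
  qed
  then have "AE x in M. \<forall>q. x \<in> B \<longrightarrow> (\<exists>n\<ge>1. (T ^^ n) x \<in> B \<and> birkhoff_sum T \<Phi> n x \<in> K q)"
    unfolding AE_all_countable by blast
  then have "AE x in M. x \<in> B \<longrightarrow>
      limit_direction_of_seq N (\<lambda>n. birkhoff_sum (induced_map T B) (induced_function T B \<Phi>) n x) u"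
  proof eventually_elim
    case (elim x)
    show ?case
    proof (intro impI limit_direction_of_seqI)
      fix q :: nat assume x: "x \<in> B"
      then obtain n where n: "(T ^^ n) x \<in> B" "birkhoff_sum T \<Phi> n x \<in> K q" using elim by blast
      from induced_birkhoff_sum[OF x n(1), of \<Phi>] obtain k where
        "birkhoff_sum (induced_map T B) (induced_function T B \<Phi>) k x = birkhoff_sum T \<Phi> n x" by blast
      with n(2) show "\<exists>k. N (birkhoff_sum (induced_map T B) (induced_function T B \<Phi>) k x) > real q \<and>
          dist (birkhoff_sum (induced_map T B) (induced_function T B \<Phi>) k x
            /\<^sub>R N (birkhoff_sum (induced_map T B) (induced_function T B \<Phi>) k x)) u < 1 / Suc q"
        by (intro exI[of _ k]) (simp add: K_def)
    qed
  qed
  then show ?thesis unfolding limit_direction_def by (rule AE_induced_measure[OF B])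
qed

end

section \<open>Reduction of the theorem to the one-sided martingale setting\<close>

theorem theorem3p2:
  fixes M F :: "'a measure" and T :: "'a \<Rightarrow> 'a"
    and \<Phi> :: "'a \<Rightarrow> real ^ 'n" and N :: "real ^ 'n \<Rightarrow> real"
  assumes "is_norm N"
    and "invertible_mps M T" and "ergodic M T"
    and "subalgebra M F"
    and "sets F \<subseteq> sets (vimage_algebra (space M) T F)"
    and "\<Phi> \<in> borel_measurable F"
    and "integrable M (\<lambda>x. (norm (\<Phi> x))\<^sup>2)"
    and "martingale_increments M (pullback_algebra M T F) (\<lambda>n. \<Phi> \<circ> int_iterate M T n)"
    and "\<not> (\<exists>a. a \<noteq> 0 \<and> (AE x in M. a \<bullet> \<Phi> x = 0))"
  shows "essential_limit_directions N M T \<Phi> = unit_sphere N"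
proof -
  let ?G = "pullback_algebra M T F"
  interpret ergodic_mps M T
    using assms(2,3) unfolding invertible_mps_def
    by (auto simp: ergodic_mps_def ergodic_mps_axioms_def)
  have nat: "(\<Phi> \<circ> int_iterate M T (int k)) x = \<Phi> ((T ^^ k) x)" for k x
    by (simp add: int_iterate_def)
  note G = assms(8)[unfolded martingale_increments_def]
  \<comment> \<open>The algebra with index n already makes the increment at time n measurable, so
    the past strictly before time k is the algebra with index k - 1.\<close>
  interpret martingale_cocycle M T \<Phi> "\<lambda>k. ?G (int k - 1)"
  proof
    fix k
    show sub: "subalgebra M (?G (int k - 1))" using G by blast
    show "sets (?G (int k - 1)) \<subseteq> sets (?G (int (Suc k) - 1))"
      using G by (metis (no_types, lifting) add.commute add_diff_cancel_left' diff_add_cancel of_nat_Suc)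
    have "\<Phi> \<circ> int_iterate M T (int k) \<in> borel_measurable (?G (int k))" using G by blast
    then show "(\<lambda>x. \<Phi> ((T ^^ k) x)) \<in> borel_measurable (?G (int (Suc k) - 1))"
      by (simp add: comp_def nat[unfolded comp_def])
    fix h i
    assume h: "h \<in> borel_measurable (?G (int k - 1))"
      and int: "integrable M (\<lambda>x. h x * \<Phi> ((T ^^ k) x) $ i)"
    interpret finite_measure_subalgebra M "?G (int k - 1)"
      by standard (rule sub)
    have "integrable M (\<Phi> \<circ> int_iterate M T (int k))" using G by blast
    then have [measurable]: "(\<lambda>x. \<Phi> ((T ^^ k) x)) \<in> borel_measurable M"
      by (simp add: comp_def nat[unfolded comp_def])
    have "AE x in M. real_cond_exp M (?G (int k - 1)) (\<lambda>x. (\<Phi> \<circ> int_iterate M T (int k)) x $ i) x = 0"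
      using G by blast
    then have zero: "AE x in M. real_cond_exp M (?G (int k - 1)) (\<lambda>x. \<Phi> ((T ^^ k) x) $ i) x = 0"
      unfolding nat .
    \<comment> \<open>The defining property of conditional expectation moves it from the increment
      onto the product with h, where it vanishes almost everywhere.\<close>
    have "(\<integral>x. h x * \<Phi> ((T ^^ k) x) $ i \<partial>M) =
        (\<integral>x. h x * real_cond_exp M (?G (int k - 1)) (\<lambda>x. \<Phi> ((T ^^ k) x) $ i) x \<partial>M)"
      by (rule real_cond_exp_intg(2)[OF int h, symmetric]) measurable
    also have "\<dots> = (\<integral>x. 0 \<partial>M)"
      using zero measurable_from_subalg[OF sub h] by (intro integral_cong_AE) auto
    finally show "(\<integral>x. h x * \<Phi> ((T ^^ k) x) $ i \<partial>M) = 0" by simp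
  qed (use assms in auto)
  show ?thesis
    using limit_direction_induced[OF assms(1)]
    by (auto simp: essential_limit_directions_def unit_sphere_def)
qed

end
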